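(* Let $\alpha\in\mathbb C$, let $n\in\mathbb N_0$, and let $(s_j)_{j=0}^{2n+2}\in\tilde{\mathcal D}_{p\times q,2n+2}$. Then: (a) $G_n^{\sharp,\alpha}=-S_n^{\sharp,\alpha}\,\Lambda_{n+1}^{[+,\alpha]}\,\mathbb S_n^{\sharp,\alpha}$, $$G_n^{\sharp,\alpha}=-R_{q,n}(\alpha)S_n^\dagger\big(K_{\alpha,n}-y_{\alpha,0,n}\,s_0^\dagger\,z_{\alpha,0,n}\big)\mathbb S_n^\dagger[R_{p,n}(\overline\alpha)]^*,$$ and $$G_n^{\sharp,\alpha}=-\nabla_{q,n+1}^*S_{n+1}^\dagger H_{n+1}\mathbb S_{n+1}^\dagger\nabla_{p,n+1}-\alpha R_{q,n}(\alpha)S_n^\dagger H_{\alpha,n}\mathbb S_n^\dagger[R_{p,n}(\overline\alpha)]^*.$$ (b) $G_n^{[+,\alpha]}=\Xi_{n,2n+2}-S_n^{[+,\alpha]}\Lambda_{n+1}^{\sharp,\alpha}\mathbb S_n^{[+,\alpha]}$. (c) $\operatorname{rank}G_n^{\sharp,\alpha}=\operatorname{rank}(\Lambda_{n+1}^{[+,\alpha]}-\Xi_{n,2n+2})$ and $\operatorname{rank}G_n^{\sharp,\alpha}=\operatorname{rank}(K_{\alpha,n}-y_{\alpha,0,n}s_0^\dagger z_{\alpha,0,n}-\Xi_{n,2n+2})$. (d) If $p=q$, then $\det(G_n^{\sharp,\alpha})=[(\det s_0)^\dagger]^{2n+2}\det(-\Lambda_{n+1}^{[+,\alpha]})$ and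 $\det(G_n^{\sharp,\alpha})=[(\det s_0)^\dagger]^{2n+2}\det[-(K_{\alpha,n}-y_{\alpha,0,n}s_0^\dagger z_{\alpha,0,n})]$.
   Context: Let $p,q\in\mathbb N=\{1,2,\dots\}$; $\mathbb N_0=\{0,1,2,\dots\}$. $(s_j)_{j=0}^{2n+2}$ is a sequence of complex $p\times q$ matrices. $A^\dagger$ is the Moore–Penrose inverse (for a scalar $c$: $c^\dagger=c^{-1}$ if $c\ne0$ and $0^\dagger=0$), $\mathcal N(A)$ the null space, $\mathcal R(A)$ the column space, $A^*$ the conjugate transpose. First term domination. $\mathcal D_{p\times q,m}$: all sequences $(s_j)_{j=0}^m$ of complex $p\times q$ matrices with $\mathcal N(s_0)\subseteq\mathcal N(s_j)$ and $\mathcal R(s_j)\subseteq\mathcal R(s_0)$ for $0\le j\le m$. For $m\ge1$, $\tilde{\mathcal D}_{p\times q,m}$: all $(s_j)_{j=0}^m$ with $(s_j)_{j=0}^{m-1}\in\mathcal D_{p\times q,m-1}$. Transforms. The $[+,\alpha]$-transform of $(s_j)$ is $(u_j)$ with $u_j=-\alpha s_{j-1}+s_j$, where $s_{-1}=0$. The reciprocal sequence of $(u_j)$ is given by $u_0^\sharp=u_0^\dagger$ and $u_j^\sharp=-u_0^\dagger\sum_{l=0}^{j-1}u_{j-l}u_l^\sharp$ for $j\ge1$ (complex $q\times p$ matrices). Put $s_j^{\sharp,\alpha}=u_j^\sharp$ where $(u_j)$ is the $[+,\alpha]$-transform of $(s_j)$. Also $s_{\alpha,j}=-\alpha s_j+s_{j+1}$.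 Block matrices. For any sequence $(x_j)$ put $G_n(x)=[x_{j+k+2}]_{j,k=0}^n$ and $$\Lambda_{n+1}(x)=G_n(x)-\begin{bmatrix}x_1\\ \vdots\\ x_{n+1}\end{bmatrix}x_0^\dagger\,[x_1,\dots,x_{n+1}].$$ Let $S_n(x)$ be the block lower triangular Toeplitz matrix with $(j,k)$ block $x_{j-k}$ for $j\ge k$ and $0$ for $j<k$, and $\mathbb S_n(x)$ the block upper triangular Toeplitz matrix with $(j,k)$ block $x_{k-j}$ for $k\ge j$ and $0$ for $k<j$ ($0\le j,k\le n$). No superscript means $x=s$: $S_n=S_n(s)$, $\mathbb S_n=\mathbb S_n(s)$. The superscript $[+,\alpha]$ means that $x=u$ is the $[+,\alpha]$-transform of $(s_j)$, and the superscript $\sharp,\alpha$ means $x_j=s_j^{\sharp,\alpha}$; thus $G_n^{[+,\alpha]}=G_n(u)$, $\Lambda_{n+1}^{[+,\alpha]}=\Lambda_{n+1}(u)$, $S_n^{[+,\alpha]}=S_n(u)$, $\mathbb S_n^{[+,\alpha]}=\mathbb S_n(u)$, and $G_n^{\sharp,\alpha},\Lambda_{n+1}^{\sharp,\alpha},S_n^{\sharp,\alpha},\mathbb S_n^{\sharp,\alpha}$ are $G_n(x),\Lambda_{n+1}(x),S_n(x),\mathbb S_n(x)$ with $x_j=s_j^{\sharp,\alpha}$. Further, $H_{n+1}=[s_{j+k}]_{j,k=0}^{n+1}$, $H_{\alpha,n}=[s_{\alpha,j+k}]_{j,k=0}^n$, $K_{\alpha,n}=[s_{\alpha,j+k+1}]_{j,k=0}^n$,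 $y_{\alpha,0,n}$ is the block column with blocks $s_{\alpha,0},\dots,s_{\alpha,n}$, and $z_{\alpha,0,n}=[s_{\alpha,0},\dots,s_{\alpha,n}]$. $R_{q,n}(z)=(I_{(n+1)q}-zT_{q,n})^{-1}$ for $z\in\mathbb C$, where $T_{q,n}=[\delta_{j,k+1}I_q]_{j,k=0}^n$; i.e. $R_{q,n}(z)$ is block lower triangular with $(j,k)$ block $z^{j-k}I_q$ for $j\ge k$; $R_{p,n}$ is the same with $p$ in place of $q$. For $n\ge1$ and $r\in\{p,q\}$, $\nabla_{r,n}=\begin{bmatrix}0_{r\times nr}\\ I_{nr}\end{bmatrix}$. Finally, $\Xi_{n,m}$ is the $(n+1)p\times(n+1)q$ block matrix (with $p\times q$ blocks) all of whose blocks are zero except the lower right corner block, which equals $s_m-s_0s_0^\dagger s_ms_0^\dagger s_0$. *)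

theory Defs
  imports
    "Jordan_Normal_Form.DL_Rank"
    "Jordan_Normal_Form.Matrix_Kernel"
    "Jordan_Normal_Form.Schur_Decomposition"
    "Jordan_Normal_Form.Gauss_Jordan_Elimination"
begin

text \<open>A finite sequence of \<open>p \<times> q\<close> matrices \<open>s\<^sub>0, \<dots>, s\<^sub>m\<close> is represented by a function
  on the naturals, of which only the values at \<open>0, \<dots>, m\<close> are ever constrained or used.\<close>

definition is_mp_inverse :: "complex mat \<Rightarrow> complex mat \<Rightarrow> bool" where
  "is_mp_inverse A X \<longleftrightarrow>
     X \<in> carrier_mat (dim_col A) (dim_row A) \<and>
     A * X * A = A \<and> X * A * X = X \<and>
     mat_adjoint (A * X) = A * X \<and> mat_adjoint (X * A) = X * A"

definition mp_inverse :: "complex mat \<Rightarrow> complex mat" where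
  "mp_inverse A = (THE X. is_mp_inverse A X)"

text \<open>The library's rank and column space take the number of rows as an explicit parameter.\<close>

definition col_space_of :: "complex mat \<Rightarrow> complex vec set" where
  "col_space_of A = vec_space.col_space (dim_row A) A"

definition rank_of :: "complex mat \<Rightarrow> nat" where
  "rank_of A = vec_space.rank (dim_row A) A"

definition first_term_dominant :: "nat \<Rightarrow> nat \<Rightarrow> nat \<Rightarrow> (nat \<Rightarrow> complex mat) set" where
  "first_term_dominant p q m =
     {s. \<forall>j\<le>m. s j \<in> carrier_mat p q \<and>
                mat_kernel (s 0) \<subseteq> mat_kernel (s j) \<and>
                col_space_of (s j) \<subseteq> col_space_of (s 0)}"

text \<open>For \<open>m \<ge> 1\<close>: the last matrix \<open>s\<^sub>m\<close> is an arbitrary \<open>p \<times> q\<close> matrix.\<close>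

definition nearly_first_term_dominant ::
    "nat \<Rightarrow> nat \<Rightarrow> nat \<Rightarrow> (nat \<Rightarrow> complex mat) set" where
  "nearly_first_term_dominant p q m =
     {s. (\<forall>j\<le>m. s j \<in> carrier_mat p q) \<and> s \<in> first_term_dominant p q (m - 1)}"

text \<open>The \<open>[+,\<alpha>]\<close>-transform; the case \<open>j = 0\<close> is the convention \<open>s\<^sub>-\<^sub>1 = 0\<close>.\<close>

definition plus_transform :: "complex \<Rightarrow> (nat \<Rightarrow> complex mat) \<Rightarrow> nat \<Rightarrow> complex mat" where
  "plus_transform \<alpha> s j = (if j = 0 then s 0 else (- \<alpha>) \<cdot>\<^sub>m s (j - 1) + s j)"

definition mat_sum :: "nat \<Rightarrow> nat \<Rightarrow> ('i \<Rightarrow> complex mat) \<Rightarrow> 'i set \<Rightarrow> complex mat" where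
  "mat_sum nr nc f A = mat nr nc (\<lambda>ij. \<Sum>l\<in>A. f l $$ ij)"

lemma mat_sum_cong [fundef_cong]:
  assumes "nr = nr'" "nc = nc'" "A = B" "\<And>l. l \<in> B \<Longrightarrow> f l = g l"
  shows "mat_sum nr nc f A = mat_sum nr' nc' g B"
  unfolding mat_sum_def using assms by (auto intro!: sum.cong)

fun reciprocal_seq :: "(nat \<Rightarrow> complex mat) \<Rightarrow> nat \<Rightarrow> complex mat" where
  "reciprocal_seq u 0 = mp_inverse (u 0)"
| "reciprocal_seq u (Suc j) =
     - (mp_inverse (u 0) *
        mat_sum (dim_row (u 0)) (dim_row (u 0))
          (\<lambda>l. u (Suc j - l) * reciprocal_seq u l) {..<Suc j})"

definition sharp_seq :: "complex \<Rightarrow> (nat \<Rightarrow> complex mat) \<Rightarrow> nat \<Rightarrow> complex mat" where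
  "sharp_seq \<alpha> s = reciprocal_seq (plus_transform \<alpha> s)"

definition shift_seq :: "complex \<Rightarrow> (nat \<Rightarrow> complex mat) \<Rightarrow> nat \<Rightarrow> complex mat" where
  "shift_seq \<alpha> s j = (- \<alpha>) \<cdot>\<^sub>m s j + s (Suc j)"

text \<open>The matrix with \<open>M \<times> N\<close> blocks \<open>f j k\<close>, each of size \<open>r \<times> c\<close>.\<close>

definition block_mat ::
    "nat \<Rightarrow> nat \<Rightarrow> nat \<Rightarrow> nat \<Rightarrow> (nat \<Rightarrow> nat \<Rightarrow> complex mat) \<Rightarrow> complex mat" where
  "block_mat r c M N f =
     mat (M * r) (N * c) (\<lambda>(i, j). f (i div r) (j div c) $$ (i mod r, j mod c))"

text \<open>In all the following matrices \<open>r \<times> c\<close> is the block size, and block indices run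
  from \<open>0\<close> to \<open>n\<close>.\<close>

definition block_hankel :: "nat \<Rightarrow> nat \<Rightarrow> nat \<Rightarrow> (nat \<Rightarrow> complex mat) \<Rightarrow> complex mat" where
  "block_hankel r c n x = block_mat r c (n + 1) (n + 1) (\<lambda>j k. x (j + k))"

definition block_column :: "nat \<Rightarrow> nat \<Rightarrow> nat \<Rightarrow> (nat \<Rightarrow> complex mat) \<Rightarrow> complex mat" where
  "block_column r c n x = block_mat r c (n + 1) 1 (\<lambda>j k. x j)"

definition block_row :: "nat \<Rightarrow> nat \<Rightarrow> nat \<Rightarrow> (nat \<Rightarrow> complex mat) \<Rightarrow> complex mat" where
  "block_row r c n x = block_mat r c 1 (n + 1) (\<lambda>j k. x k)"

definition G_mat :: "nat \<Rightarrow> nat \<Rightarrow> nat \<Rightarrow> (nat \<Rightarrow> complex mat) \<Rightarrow> complex mat" where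
  "G_mat r c n x = block_hankel r c n (\<lambda>j. x (j + 2))"

text \<open>This is \<open>\<Lambda>\<^sub>n\<^sub>+\<^sub>1(x)\<close>; the block column and row have the entries \<open>x\<^sub>1, \<dots>, x\<^sub>n\<^sub>+\<^sub>1\<close>.\<close>

definition Lambda_Suc :: "nat \<Rightarrow> nat \<Rightarrow> nat \<Rightarrow> (nat \<Rightarrow> complex mat) \<Rightarrow> complex mat" where
  "Lambda_Suc r c n x =
     G_mat r c n x -
     block_column r c n (\<lambda>j. x (j + 1)) * mp_inverse (x 0) * block_row r c n (\<lambda>j. x (j + 1))"

definition S_lower :: "nat \<Rightarrow> nat \<Rightarrow> nat \<Rightarrow> (nat \<Rightarrow> complex mat) \<Rightarrow> complex mat" where
  "S_lower r c n x =
     block_mat r c (n + 1) (n + 1) (\<lambda>j k. if k \<le> j then x (j - k) else 0\<^sub>m r c)"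

definition S_upper :: "nat \<Rightarrow> nat \<Rightarrow> nat \<Rightarrow> (nat \<Rightarrow> complex mat) \<Rightarrow> complex mat" where
  "S_upper r c n x =
     block_mat r c (n + 1) (n + 1) (\<lambda>j k. if j \<le> k then x (k - j) else 0\<^sub>m r c)"

definition H_shift ::
    "complex \<Rightarrow> nat \<Rightarrow> nat \<Rightarrow> nat \<Rightarrow> (nat \<Rightarrow> complex mat) \<Rightarrow> complex mat" where
  "H_shift \<alpha> p q n s = block_hankel p q n (shift_seq \<alpha> s)"

definition K_shift ::
    "complex \<Rightarrow> nat \<Rightarrow> nat \<Rightarrow> nat \<Rightarrow> (nat \<Rightarrow> complex mat) \<Rightarrow> complex mat" where
  "K_shift \<alpha> p q n s = block_hankel p q n (\<lambda>j. shift_seq \<alpha> s (j + 1))"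

definition y_shift ::
    "complex \<Rightarrow> nat \<Rightarrow> nat \<Rightarrow> nat \<Rightarrow> (nat \<Rightarrow> complex mat) \<Rightarrow> complex mat" where
  "y_shift \<alpha> p q n s = block_column p q n (shift_seq \<alpha> s)"

definition z_shift ::
    "complex \<Rightarrow> nat \<Rightarrow> nat \<Rightarrow> nat \<Rightarrow> (nat \<Rightarrow> complex mat) \<Rightarrow> complex mat" where
  "z_shift \<alpha> p q n s = block_row p q n (shift_seq \<alpha> s)"

definition T_mat :: "nat \<Rightarrow> nat \<Rightarrow> complex mat" where
  "T_mat r n =
     block_mat r r (n + 1) (n + 1) (\<lambda>j k. if j = k + 1 then 1\<^sub>m r else 0\<^sub>m r r)"

text \<open>The inverted matrix is unit lower triangular, so \<^const>\<open>mat_inverse\<close> never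
  returns \<^const>\<open>None\<close> here.\<close>

definition R_mat :: "nat \<Rightarrow> nat \<Rightarrow> complex \<Rightarrow> complex mat" where
  "R_mat r n z = the (mat_inverse (1\<^sub>m ((n + 1) * r) - z \<cdot>\<^sub>m T_mat r n))"

text \<open>The zero matrix of size \<open>r \<times> nr\<close> on top of the identity matrix of size \<open>nr \<times> nr\<close>.\<close>

definition nabla_mat :: "nat \<Rightarrow> nat \<Rightarrow> complex mat" where
  "nabla_mat r n = 0\<^sub>m r (n * r) @\<^sub>r 1\<^sub>m (n * r)"

definition Xi_mat ::
    "nat \<Rightarrow> nat \<Rightarrow> nat \<Rightarrow> nat \<Rightarrow> (nat \<Rightarrow> complex mat) \<Rightarrow> complex mat" where
  "Xi_mat p q n m s =
     block_mat p q (n + 1) (n + 1)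
       (\<lambda>j k. if j = n \<and> k = n
              then s m - s 0 * mp_inverse (s 0) * s m * mp_inverse (s 0) * s 0
              else 0\<^sub>m p q)"

end

theory Submission
  imports Defs
begin

text \<open>
Read a sequence of matrices as the power series \<open>\<Sum> x\<^sub>j z\<^sup>j\<close>. Block triangular Toeplitz matrices
represent multiplication by a series, the plus transform is multiplication by \<open>1 - \<alpha> z\<close>, and
\<open>R(\<alpha>)\<close> is the Toeplitz matrix of \<open>1 / (1 - \<alpha> z)\<close>.

Put \<open>P = s\<^sub>0 s\<^sub>0\<^sup>\<dagger>\<close> and \<open>Q = s\<^sub>0\<^sup>\<dagger> s\<^sub>0\<close>. Domination by the first term means \<open>P u\<^sub>j = u\<^sub>j = u\<^sub>j Q\<close>. For such
a sequence \<open>u\<close>, the reciprocal sequence \<open>v\<close> is an inverse power series in the corner cut out by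
the two projections: \<open>u v = P\<close> and \<open>v u = Q\<close> (locale \<open>reciprocal_pair\<close>; the nontrivial half is
that the recursively defined right inverse is also a left inverse). This relation is symmetric.

Write \<open>S\<close> and \<open>\<S>\<close> for lower and upper triangular Toeplitz matrices. Positive coefficients of
\<open>v u\<close> vanish. Splitting such a coefficient into two parts expresses Hankel matrices of \<open>u\<close>, multiplied
by \<open>S(v)\<close>, through Hankel matrices of \<open>v\<close>, multiplied by \<open>\<S>(u)\<close>. For \<open>G\<close> there remains a correction of
the form column times row, and the Schur complement \<open>\<Lambda>\<close> is built to cancel it:
\<open>S(v) \<Lambda>(u) = - G(v) \<S>(u)\<close>. Multiplying by \<open>\<S>(v)\<close> gives the first formula of (a), and exchanging
\<open>u\<close> and \<open>v\<close> gives (b).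

The second formula of (a) is the first one rewritten. Since \<open>s\<^sub>\<alpha>\<^sub>,\<^sub>j = u\<^sub>j\<^sub>+\<^sub>1\<close>, its middle factor is
\<open>\<Lambda>(u)\<close>. If \<open>w\<close> is reciprocal to \<open>s\<close>, then \<open>w = (1 - \<alpha> z) v\<close>, so \<open>S(v) = R(\<alpha>) S(w)\<close>, and \<open>S(w)\<close> is the
Moore-Penrose inverse of \<open>S(s)\<close>, as the products of both are block diagonal with blocks \<open>P\<close>
and \<open>Q\<close>. The third formula reads \<open>v\<^sub>j\<^sub>+\<^sub>2 = w\<^sub>j\<^sub>+\<^sub>2 + \<alpha> v\<^sub>j\<^sub>+\<^sub>1\<close> blockwise.

The last matrix \<open>s\<^sub>2\<^sub>n\<^sub>+\<^sub>2\<close> need not be dominated. Everything is therefore proved for the compressed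
sequence \<open>P s\<^sub>j Q\<close>. Compression changes neither the reciprocal sequences nor, applied to
the blocks of \<open>M\<close>, a product \<open>S(v) M \<S>(v)\<close>, while \<open>G(u)\<close> and \<open>\<Lambda>(u)\<close> lose exactly \<open>\<Xi>\<close>.

For (c), \<open>G(v)\<close> and \<open>\<Lambda>\<close> of the compressed sequence arise from each other by multiplication with
matrices on both sides. For (d), the Toeplitz matrices in the first formula of (a) are block
triangular with diagonal blocks \<open>s\<^sub>0\<^sup>\<dagger>\<close>, and \<open>det s\<^sub>0\<^sup>\<dagger>\<close> is the inverse of \<open>det s\<^sub>0\<close>.
\<close>

section \<open>Matrix products and adjoints\<close>

text \<open>Stated with dimensions instead of carriers, associativity is a rewrite rule whose side
conditions the simplifier can decide.\<close>

lemma mult_mat_assoc: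
  fixes A B C :: "'a :: semiring_0 mat"
  assumes "dim_col A = dim_row B" "dim_col B = dim_row C"
  shows "A * B * C = A * (B * C)"
  by (rule assoc_mult_mat[of A "dim_row A" "dim_row B" B "dim_row C" C "dim_col C"])
    (use assms in auto)

lemma index_mult_mat_sum:
  fixes A B :: "'a :: semiring_0 mat"
  assumes "A \<in> carrier_mat r m" "B \<in> carrier_mat m c" "i < r" "j < c"
  shows "(A * B) $$ (i, j) = (\<Sum>k<m. A $$ (i, k) * B $$ (k, j))"
  using assms by (auto simp: scalar_prod_def atLeast0LessThan)

lemma mat_adjoint_alt:
  "mat_adjoint A = mat (dim_col A) (dim_row A) (\<lambda>(i, j). cnj (A $$ (j, i)))"
  by (rule eq_matI) (auto simp: mat_adjoint_def mat_of_rows_def)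

lemma dim_mat_adjoint [simp]:
  fixes A :: "complex mat"
  shows "dim_row (mat_adjoint A) = dim_col A" "dim_col (mat_adjoint A) = dim_row A"
  by (simp_all add: mat_adjoint_alt)

lemma mat_adjoint_carrier [simp]:
  fixes A :: "complex mat"
  shows "mat_adjoint A \<in> carrier_mat r c \<longleftrightarrow> A \<in> carrier_mat c r"
  by (metis carrier_matD carrier_matI dim_mat_adjoint)

lemma mat_adjoint_adjoint [simp]:
  fixes A :: "complex mat"
  shows "mat_adjoint (mat_adjoint A) = A"
  by (rule eq_matI) (auto simp: mat_adjoint_alt)

lemma mat_adjoint_mult:
  fixes A B :: "complex mat"
  assumes "dim_col A = dim_row B"
  shows "mat_adjoint (A * B) = mat_adjoint B * mat_adjoint A"
  by (rule eq_matI)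
    (use assms in \<open>auto simp: mat_adjoint_alt scalar_prod_def mult.commute\<close>)

text \<open>The diagonal entries of \<open>A\<^sup>* A\<close> are the squared norms of the columns of \<open>A\<close>.\<close>

lemma adjoint_mult_self_eq_0:
  fixes A :: "complex mat"
  assumes A: "A \<in> carrier_mat r c" and zero: "mat_adjoint A * A = 0\<^sub>m c c"
  shows "A = 0\<^sub>m r c"
proof (rule eq_matI)
  fix i j assume "i < dim_row (0\<^sub>m r c :: complex mat)" "j < dim_col (0\<^sub>m r c :: complex mat)"
  then have ij: "i < r" "j < c" by auto
  have "(mat_adjoint A * A) $$ (j, j) = (\<Sum>k<r. of_real ((cmod (A $$ (k, j)))\<^sup>2))"
    using A ij by (auto simp: mat_adjoint_alt scalar_prod_def atLeast0LessThan
        complex_norm_square mult.commute simp del: of_real_power)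
  also have "\<dots> = of_real (\<Sum>k<r. (cmod (A $$ (k, j)))\<^sup>2)" by simp
  finally have "(\<Sum>k<r. (cmod (A $$ (k, j)))\<^sup>2) = 0"
    using zero ij by (metis index_zero_mat(1) of_real_eq_0_iff)
  then have "(cmod (A $$ (i, j)))\<^sup>2 = 0"
    by (subst (asm) sum_nonneg_eq_0_iff) (use ij in auto)
  then show "A $$ (i, j) = 0\<^sub>m r c $$ (i, j)" using ij by simp
qed (use A in auto)

section \<open>The Moore-Penrose inverse\<close>

text \<open>Wedderburn's rank reduction. Given a nonzero entry at \<open>(i, j)\<close>, let \<open>E\<close> have the single
nonzero entry \<open>1 / A\<^sub>i\<^sub>j\<close> at \<open>(j, i)\<close>. The matrix \<open>A' = A - A E A\<close> has fewer nonzero rows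
than \<open>A\<close>, and \<open>A' = (1 - A E) A = A (1 - E A)\<close>. Hence an inner inverse \<open>X\<close> of \<open>A'\<close> yields the
inner inverse \<open>(1 - E A) X (1 - A E) + E\<close> of \<open>A\<close>.\<close>

lemma ex_inner_inverse:
  fixes A :: "'a :: field mat"
  assumes "A \<in> carrier_mat r c"
  shows "\<exists>X \<in> carrier_mat c r. A * X * A = A"
  using assms
proof (induction "card {i. i < r \<and> (\<exists>j<c. A $$ (i, j) \<noteq> 0)}" arbitrary: A rule: less_induct)
  case less
  note A = less.prems
  show ?case
  proof (cases "\<exists>i<r. \<exists>j<c. A $$ (i, j) \<noteq> 0")
    case False
    then have "A = 0\<^sub>m r c" using A by (intro eq_matI) auto
    then show ?thesis by (intro bexI[of _ "0\<^sub>m c r"]) auto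
  next
    case True
    then obtain i j where ij: "i < r" "j < c" "A $$ (i, j) \<noteq> 0" by auto
    define E where "E = mat c r (\<lambda>(k, l). if k = j \<and> l = i then 1 / A $$ (i, j) else 0)"
    have E: "E \<in> carrier_mat c r" by (simp add: E_def)
    define A' where "A' = A - A * E * A"
    have A': "A' \<in> carrier_mat r c" using A E by (auto simp: A'_def)
    have AE: "(A * E) $$ (a, b) = (if b = i then A $$ (a, j) / A $$ (i, j) else 0)"
      if "a < r" "b < r" for a b
    proof -
      have "(A * E) $$ (a, b) = (\<Sum>k<c. A $$ (a, k) * E $$ (k, b))"
        by (rule index_mult_mat_sum) (use A E that in auto)
      also have "\<dots> = (\<Sum>k<c. if k = j then if b = i then A $$ (a, j) / A $$ (i, j) else 0 else 0)"
        using that by (intro sum.cong) (auto simp: E_def)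
      finally show ?thesis using ij by simp
    qed
    have A'_index: "A' $$ (a, b) = A $$ (a, b) - A $$ (a, j) / A $$ (i, j) * A $$ (i, b)"
      if "a < r" "b < c" for a b
    proof -
      have "(A * E * A) $$ (a, b) = (\<Sum>k<r. (A * E) $$ (a, k) * A $$ (k, b))"
        by (rule index_mult_mat_sum) (use A E that in auto)
      also have "\<dots> = (\<Sum>k<r. if k = i then A $$ (a, j) / A $$ (i, j) * A $$ (i, b) else 0)"
        using that by (intro sum.cong) (auto simp: AE)
      finally show ?thesis using ij A E that by (simp add: A'_def)
    qed
    have "{a. a < r \<and> (\<exists>b<c. A' $$ (a, b) \<noteq> 0)} \<subset> {a. a < r \<and> (\<exists>b<c. A $$ (a, b) \<noteq> 0)}"
    proof (rule psubsetI)
      show "{a. a < r \<and> (\<exists>b<c. A' $$ (a, b) \<noteq> 0)} \<subseteq> {a. a < r \<and> (\<exists>b<c. A $$ (a, b) \<noteq> 0)}"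
      proof clarify
        fix a b assume ab: "a < r" "b < c" "A' $$ (a, b) \<noteq> 0"
        then have "A $$ (a, b) \<noteq> 0 \<or> A $$ (a, j) \<noteq> 0" by (auto simp: A'_index)
        then show "\<exists>b<c. A $$ (a, b) \<noteq> 0" using ab ij by blast
      qed
      have "i \<notin> {a. a < r \<and> (\<exists>b<c. A' $$ (a, b) \<noteq> 0)}" using ij by (auto simp: A'_index)
      then show "{a. a < r \<and> (\<exists>b<c. A' $$ (a, b) \<noteq> 0)} \<noteq> {a. a < r \<and> (\<exists>b<c. A $$ (a, b) \<noteq> 0)}"
        using ij by blast
    qed
    then have "card {a. a < r \<and> (\<exists>b<c. A' $$ (a, b) \<noteq> 0)}
        < card {a. a < r \<and> (\<exists>b<c. A $$ (a, b) \<noteq> 0)}"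
      by (intro psubset_card_mono) auto
    from less.hyps[OF this A'] obtain X where X: "X \<in> carrier_mat c r" "A' * X * A' = A'" by auto
    have 1: "A * (1\<^sub>m c - E * A) = A'"
      using A E by (simp add: A'_def mult_minus_distrib_mat[of A r c _ c])
    have 2: "(1\<^sub>m r - A * E) * A = A'"
      using A E by (simp add: A'_def minus_mult_distrib_mat[of _ r r _ A c])
    define Y where "Y = (1\<^sub>m c - E * A) * X * (1\<^sub>m r - A * E)"
    have Y: "Y \<in> carrier_mat c r" using A E X by (auto simp: Y_def)
    have "A * (Y + E) * A = A * Y * A + A * E * A"
      using A E Y by (simp add: mult_add_distrib_mat[of A r c _ r] add_mult_distrib_mat[of _ r r _ A c])
    also have "A * Y * A = (A * (1\<^sub>m c - E * A)) * X * ((1\<^sub>m r - A * E) * A)"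
      using A E X unfolding Y_def by (simp add: mult_mat_assoc del: assoc_mult_mat)
    also have "\<dots> = A'" unfolding 1 2 by (rule X)
    also have "A' + A * E * A = A" unfolding A'_def using A E by (intro eq_matI) auto
    finally show ?thesis using E Y by (intro bexI[of _ "Y + E"]) auto
  qed
qed

lemma mat_minus_eq_0D:
  fixes A B :: "complex mat"
  assumes "A - B = 0\<^sub>m r c" "A \<in> carrier_mat r c" "B \<in> carrier_mat r c"
  shows "A = B"
proof (rule eq_matI)
  fix i j assume "i < dim_row B" "j < dim_col B"
  then have "(A - B) $$ (i, j) = A $$ (i, j) - B $$ (i, j)"
    using assms(2,3) by auto
  moreover have "(A - B) $$ (i, j) = 0" unfolding assms(1) using \<open>i < _\<close> \<open>j < _\<close> assms(3) by auto
  ultimately show "A $$ (i, j) = B $$ (i, j)" by simp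
qed (use assms in auto)

text \<open>The matrix \<open>A D\<close> with \<open>D = M - N\<close> satisfies \<open>(A D)\<^sup>* (A D) = D\<^sup>* (A\<^sup>* A D) = 0\<close>.\<close>

lemma adjoint_mult_cancel:
  fixes A M N :: "complex mat"
  assumes A: "A \<in> carrier_mat r c" and M: "M \<in> carrier_mat c k" and N: "N \<in> carrier_mat c k"
    and eq: "mat_adjoint A * (A * M) = mat_adjoint A * (A * N)"
  shows "A * M = A * N"
proof -
  define D where "D = M - N"
  have D: "D \<in> carrier_mat c k" using M N by (auto simp: D_def)
  have AD: "A * D = A * M - A * N" using A M N by (simp add: D_def mult_minus_distrib_mat)
  have "mat_adjoint (A * D) * (A * D) = mat_adjoint D * (mat_adjoint A * (A * D))"
    using A D by (simp add: mat_adjoint_mult mult_mat_assoc)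
  also have "mat_adjoint A * (A * D) = mat_adjoint A * (A * M) - mat_adjoint A * (A * N)"
    unfolding AD using A M N by (intro mult_minus_distrib_mat[of _ c r]) auto
  also have "\<dots> = 0\<^sub>m c k" unfolding eq using A N by (intro eq_matI) auto
  also have "mat_adjoint D * 0\<^sub>m c k = 0\<^sub>m k k" using D by simp
  finally have "A * D = 0\<^sub>m r k" by (rule adjoint_mult_self_eq_0[OF mult_carrier_mat[OF A D]])
  then show ?thesis unfolding AD 
    by (rule mat_minus_eq_0D) (use A M N in auto)
qed

text \<open>If \<open>Z\<close> is an inner inverse of \<open>A\<^sup>* A\<close>, then so is \<open>Z\<^sup>*\<close>, and cancelling \<open>A\<^sup>*\<close> gives
\<open>A Z A\<^sup>* A = A\<close> for both. So \<open>Y = Z A\<^sup>*\<close> is an inner inverse of \<open>A\<close>, and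
\<open>(A Y)\<^sup>* (A Y) = A Z\<^sup>* A\<^sup>* A Z A\<^sup>* = A Y\<close> exhibits \<open>A Y\<close> as Hermitian.\<close>

lemma ex_least_squares_inverse:
  fixes A :: "complex mat"
  assumes A: "A \<in> carrier_mat r c"
  shows "\<exists>Y \<in> carrier_mat c r. A * Y * A = A \<and> mat_adjoint (A * Y) = A * Y"
proof -
  let ?A = "mat_adjoint A"
  obtain Z where Z: "Z \<in> carrier_mat c c" "?A * A * Z * (?A * A) = ?A * A"
    using ex_inner_inverse[of "?A * A" c c] A by auto
  have *: "A * (W * (?A * A)) = A" if W: "W \<in> carrier_mat c c" "?A * A * W * (?A * A) = ?A * A" for W
  proof -
    have "A * (W * (?A * A)) = A * 1\<^sub>m c"
      using A W by (intro adjoint_mult_cancel[of A r c _ c]) (simp_all add: mult_mat_assoc)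
    then show ?thesis using A by simp
  qed
  have "mat_adjoint (?A * A * Z * (?A * A)) = mat_adjoint (?A * A)" using Z by simp
  then have Z': "?A * A * mat_adjoint Z * (?A * A) = ?A * A"
    using A Z(1) by (simp add: mat_adjoint_mult mult_mat_assoc)
  define Y where "Y = Z * ?A"
  have Y: "Y \<in> carrier_mat c r" using A Z by (simp add: Y_def)
  have inner: "A * Y * A = A" using *[OF Z] A Z by (simp add: Y_def mult_mat_assoc)
  have AY': "mat_adjoint (A * Y) = A * (mat_adjoint Z * ?A)"
    using A Z by (simp add: Y_def mat_adjoint_mult mult_mat_assoc)
  have "mat_adjoint (A * Y) * (A * Y) = A * (mat_adjoint Z * (?A * A)) * Y"
    unfolding AY' using A Y Z by (simp add: mult_mat_assoc)
  also have "\<dots> = A * Y" using *[OF _ Z'] Z by simp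
  finally have **: "mat_adjoint (A * Y) * (A * Y) = A * Y" .
  have "mat_adjoint (mat_adjoint (A * Y) * (A * Y)) = mat_adjoint (A * Y) * (A * Y)"
    using A Y by (simp add: mat_adjoint_mult[of "mat_adjoint (A * Y)"])
  then have "mat_adjoint (A * Y) = A * Y" unfolding ** .
  with Y inner show ?thesis by blast
qed

text \<open>A least squares inverse \<open>Y\<close> of \<open>A\<close> makes \<open>A Y\<close> Hermitian; the adjoint \<open>V\<close> of a least squares
inverse of \<open>A\<^sup>*\<close> makes \<open>V A\<close> Hermitian. The product \<open>V A Y\<close> inherits both properties.\<close>

lemma ex_mp_inverse: "\<exists>X. is_mp_inverse A X"
proof -
  define r c where "r = dim_row A" and "c = dim_col A"
  have A: "A \<in> carrier_mat r c" by (auto simp: r_def c_def)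
  obtain Y where Y: "Y \<in> carrier_mat c r" "A * Y * A = A" "mat_adjoint (A * Y) = A * Y"
    using ex_least_squares_inverse[OF A] by auto
  obtain W where W: "W \<in> carrier_mat r c" "mat_adjoint A * W * mat_adjoint A = mat_adjoint A"
      "mat_adjoint (mat_adjoint A * W) = mat_adjoint A * W"
    using ex_least_squares_inverse[of "mat_adjoint A" c r] A by auto
  define V where "V = mat_adjoint W"
  have V: "V \<in> carrier_mat c r" using W by (simp add: V_def)
  have "mat_adjoint (mat_adjoint A * W * mat_adjoint A) = A" using W by simp
  then have AVA: "A * V * A = A" using A W(1) by (simp add: mat_adjoint_mult V_def mult_mat_assoc)
  have VA: "mat_adjoint (V * A) = V * A"
    using W(3) A W(1) by (simp add: V_def mat_adjoint_mult)
  define X where "X = V * A * Y"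
  have AX: "A * X = A * Y"
  proof -
    have "A * X = A * V * A * Y" unfolding X_def using A V Y by (simp add: mult_mat_assoc)
    then show ?thesis unfolding AVA .
  qed
  have XA: "X * A = V * A"
  proof -
    have "X * A = V * (A * Y * A)" unfolding X_def using A V Y(1) by (simp add: mult_mat_assoc)
    then show ?thesis unfolding Y(2) .
  qed
  have "X * A * X = V * (A * X)" unfolding XA using A V Y by (simp add: mult_mat_assoc X_def)
  also have "\<dots> = X" unfolding AX using A V Y by (simp add: mult_mat_assoc X_def)
  finally have "X * A * X = X" .
  then have "is_mp_inverse A X"
    unfolding is_mp_inverse_def AX XA using Y V VA A by (auto simp: X_def)
  then show ?thesis ..
qed

text \<open>The two Hermitian projections onto the range of \<open>A\<close> coincide, \<open>A X = A Y\<close>, and likewise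
\<open>X A = Y A\<close>; then \<open>X = X A X = Y A Y = Y\<close>.\<close>

lemma mp_inverse_unique:
  assumes X: "is_mp_inverse A X" and Y: "is_mp_inverse A Y"
  shows "X = Y"
proof -
  define r c where "r = dim_row A" and "c = dim_col A"
  have A: "A \<in> carrier_mat r c" by (auto simp: r_def c_def)
  have dims: "X \<in> carrier_mat c r" "Y \<in> carrier_mat c r"
    using X Y by (auto simp: is_mp_inverse_def r_def c_def)
  have AXY: "A * X = A * Y"
  proof -
    have "A * X = (A * Y * A) * X" using Y by (simp add: is_mp_inverse_def)
    also have "\<dots> = (A * Y) * (A * X)" using A dims by (simp add: mult_mat_assoc)
    also have "\<dots> = mat_adjoint (A * Y) * mat_adjoint (A * X)"
      using X Y by (simp add: is_mp_inverse_def)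
    also have "\<dots> = mat_adjoint (A * X * A * Y)"
      using A dims by (simp add: mat_adjoint_mult mult_mat_assoc)
    also have "\<dots> = A * Y" using X Y by (simp add: is_mp_inverse_def)
    finally show ?thesis .
  qed
  have XYA: "X * A = Y * A"
  proof -
    have "X * A = X * (A * Y * A)" using Y by (simp add: is_mp_inverse_def)
    also have "\<dots> = (X * A) * (Y * A)" using A dims by (simp add: mult_mat_assoc)
    also have "\<dots> = mat_adjoint (X * A) * mat_adjoint (Y * A)"
      using X Y by (simp add: is_mp_inverse_def)
    also have "\<dots> = mat_adjoint (Y * (A * X * A))"
      using A dims by (simp add: mat_adjoint_mult mult_mat_assoc)
    also have "\<dots> = Y * A" using X Y by (simp add: is_mp_inverse_def)
    finally show ?thesis .
  qed
  have "X = X * A * X" using X by (simp add: is_mp_inverse_def)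
  also have "\<dots> = Y * (A * X)" unfolding XYA using A dims by (simp add: mult_mat_assoc)
  also have "\<dots> = Y * A * Y" unfolding AXY using A dims by (simp add: mult_mat_assoc)
  also have "\<dots> = Y" using Y by (simp add: is_mp_inverse_def)
  finally show ?thesis .
qed

lemma mp_inverse_eqI: "is_mp_inverse A X \<Longrightarrow> mp_inverse A = X"
  unfolding mp_inverse_def using mp_inverse_unique by blast

lemma is_mp_inverse_mp_inverse: "is_mp_inverse A (mp_inverse A)"
  using ex_mp_inverse mp_inverse_eqI by metis

lemma is_mp_inverse_sym: "is_mp_inverse A X \<Longrightarrow> is_mp_inverse X A"
  unfolding is_mp_inverse_def by (metis carrier_matD carrier_matI)

lemma dim_mp_inverse [simp]: "dim_row (mp_inverse A) = dim_col A" "dim_col (mp_inverse A) = dim_row A"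
  using is_mp_inverse_mp_inverse[of A] by (auto simp: is_mp_inverse_def)

lemma mp_inverse_mp_inverse: "mp_inverse (mp_inverse A) = A"
  by (rule mp_inverse_eqI[OF is_mp_inverse_sym[OF is_mp_inverse_mp_inverse]])

text \<open>With \<open>d = det A\<close> and \<open>x = det A\<^sup>\<dagger>\<close>, the defining equations give \<open>d x d = d\<close> and \<open>x d x = x\<close>.
This pins down \<open>x\<close> also for \<open>d = 0\<close>, where the inverse in a field is \<open>0\<close> by convention.\<close>

lemma det_mp_inverse:
  assumes A: "A \<in> carrier_mat n n"
  shows "det (mp_inverse A) = inverse (det A)"
proof -
  let ?X = "mp_inverse A"
  note X = is_mp_inverse_mp_inverse[of A, unfolded is_mp_inverse_def]
  have c: "?X \<in> carrier_mat n n" using X A by auto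
  have "det (A * ?X * A) = det A" "det (?X * A * ?X) = det ?X" using X by auto
  then have "det A * det ?X * det A = det A" "det ?X * det A * det ?X = det ?X"
    using A c by (simp_all only: det_mult[of _ n] mult_carrier_mat[of _ n n _ n])
  then show ?thesis
    by (cases "det A = 0") (auto intro!: inverse_unique[symmetric])
qed

section \<open>Rank and factorizations\<close>

text \<open>Together with the next lemma: the rank is the least inner dimension of a factorization. This
turns bounds for the rank of a product, on either side, into regrouping of factors.\<close>

lemma (in vec_space) rank_le_of_factorization:
  assumes C: "C \<in> carrier_mat n k" and D: "D \<in> carrier_mat k nc"
  shows "rank (C * D) \<le> k"
proof -
  have sub: "set (cols (C * D)) \<subseteq> span (set (cols C))"
  proof
    fix x assume "x \<in> set (cols (C * D))"
    then obtain j where j: "j < nc" "x = col (C * D) j" using C D by (auto simp: cols_def)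
    then have "x = C *\<^sub>v col D j" using C D by (intro eq_vecI) auto
    then have "x \<in> col_space C" using C D j by (subst col_space_eq[OF C]) auto
    then show "x \<in> span (set (cols C))" by (simp add: col_space_def)
  qed
  have colsC: "set (cols C) \<subseteq> carrier_vec n" using C cols_dim by blast
  have colsCD: "set (cols (C * D)) \<subseteq> carrier_vec n" using C D cols_dim[of "C * D"] by auto
  obtain S where S: "maximal S (\<lambda>T. T \<subseteq> set (cols (C * D)) \<and> lin_indpt T)" "finite S"
    using maximal_exists_superset[of "set (cols (C * D))" "\<lambda>T. T \<subseteq> set (cols (C * D)) \<and> lin_indpt T" "{}"]
    by (auto simp: lin_dep_def)
  have "rank (C * D) = card S" using C D by (intro rank_card_indpt[OF _ S(1)]) auto
  also have "card S \<le> card (set (cols C))"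
  proof -
    have "S \<subseteq> span (set (cols C))" "lin_indpt S" using S sub by (auto simp: maximal_def)
    then obtain T :: "'a vec set" where "int (card T) \<le> int (card (set (cols C))) - int (card S)"
      using replacement[OF S(2) List.finite_set, of "cols C"] colsC by auto
    then show ?thesis by linarith
  qed
  also have "card (set (cols C)) \<le> k" using C card_length[of "cols C"] by simp
  finally show ?thesis .
qed

lemma (in vec_space) ex_rank_factorization:
  assumes A: "A \<in> carrier_mat n nc"
  shows "\<exists>C \<in> carrier_mat n (rank A). \<exists>D \<in> carrier_mat (rank A) nc. A = C * D"
proof -
  have colsA: "set (cols A) \<subseteq> carrier_vec n" using A cols_dim by blast
  obtain S where S: "maximal S (\<lambda>T. T \<subseteq> set (cols A) \<and> lin_indpt T)" "finite S"
    using maximal_exists_superset[of "set (cols A)" "\<lambda>T. T \<subseteq> set (cols A) \<and> lin_indpt T" "{}"]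
    by (auto simp: lin_dep_def)
  have S': "S \<subseteq> set (cols A)" "lin_indpt S" using S by (auto simp: maximal_def)
  have card: "rank A = card S" by (rule rank_card_indpt[OF A S(1)])
  have span: "x \<in> span S" if x: "x \<in> set (cols A)" for x
  proof (rule ccontr)
    assume nx: "x \<notin> span S"
    have Sn: "S \<subseteq> carrier_vec n" using S'(1) colsA by (rule subset_trans)
    then have nS: "x \<notin> S" using nx span_mem[of S x] by auto
    have "x \<in> carrier_vec n" using x colsA by (rule set_mp[rotated])
    then have "lin_indpt (S \<union> {x})"
      using lin_dep_iff_in_span[of S x] Sn S'(2) nS nx by simp
    moreover have "S \<subseteq> S \<union> {x}" "S \<union> {x} \<subseteq> set (cols A)" using S'(1) x by auto
    ultimately have "S \<union> {x} = S" using S(1) unfolding maximal_def by blast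
    then show False using nS by blast
  qed
  obtain ss where ss: "set ss = S" "distinct ss" using S(2) finite_distinct_list by blast
  define C where "C = mat_of_cols n ss"
  have C: "C \<in> carrier_mat n (rank A)" using ss card distinct_card[of ss] by (auto simp: C_def)
  have colsC: "cols C = ss" unfolding C_def using ss S' colsA by (intro cols_mat_of_cols) auto
  have "\<exists>d \<in> carrier_vec (rank A). C *\<^sub>v d = col A j" if "j < nc" for j
  proof -
    have "col A j \<in> span S" using span that A by (auto simp: cols_def)
    then have "col A j \<in> col_space C" by (simp add: col_space_def colsC ss)
    then show ?thesis unfolding col_space_eq[OF C] using C by auto
  qed
  then obtain d where d: "\<And>j. j < nc \<Longrightarrow> d j \<in> carrier_vec (rank A) \<and> C *\<^sub>v d j = col A j" by metis
  define D where "D = mat (rank A) nc (\<lambda>(i, j). d j $ i)"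
  have D: "D \<in> carrier_mat (rank A) nc" by (simp add: D_def)
  have "A = C * D"
  proof (rule mat_col_eqI)
    fix j assume "j < dim_col (C * D)"
    then have j: "j < nc" by (simp add: D_def)
    have "col D j = d j" using d[OF j] j by (intro eq_vecI) (auto simp: D_def)
    then show "col A j = col (C * D) j" unfolding col_mult2[OF C D j] using d[OF j] by simp
  qed (use A C D in auto)
  then show ?thesis using C D by blast
qed

lemma rank_of_mult_le:
  assumes A: "A \<in> carrier_mat r m" and B: "B \<in> carrier_mat m k" and C: "C \<in> carrier_mat k c"
  shows "rank_of (A * B * C) \<le> rank_of B"
proof -
  obtain E F where EF: "E \<in> carrier_mat m (rank_of B)" "F \<in> carrier_mat (rank_of B) k" "B = E * F"
    using vec_space.ex_rank_factorization[OF B] B unfolding rank_of_def by auto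
  have eq: "A * B * C = (A * E) * (F * C)" using A C EF by (subst EF(3)) (simp add: mult_mat_assoc)
  have "vec_space.rank r ((A * E) * (F * C)) \<le> rank_of B"
    by (rule vec_space.rank_le_of_factorization) (use A C EF in auto)
  then show ?thesis unfolding eq using A EF by (simp add: rank_of_def)
qed

section \<open>Block matrices\<close>

lemma dim_block_mat [simp]:
  "dim_row (block_mat r c M N f) = M * r" "dim_col (block_mat r c M N f) = N * c"
  by (simp_all add: block_mat_def)

lemma block_mat_carrier [simp]: "block_mat r c M N f \<in> carrier_mat (M * r) (N * c)"
  by (simp add: carrier_matI)

lemma block_index_less:
  fixes j M a r :: nat
  assumes "j < M" "a < r"
  shows "j * r + a < M * r"
proof -
  have "j * r + a < Suc j * r" using assms by simp
  also have "\<dots> \<le> M * r" using assms by (intro mult_le_mono1) simp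
  finally show ?thesis .
qed

lemma index_block_mat:
  assumes "j < M" "k < N" "a < r" "b < c"
  shows "block_mat r c M N f $$ (j * r + a, k * c + b) = f j k $$ (a, b)"
  using assms by (simp add: block_mat_def block_index_less)

lemma eq_matI_blocks:
  assumes "A \<in> carrier_mat (M * r) (N * c)" "B \<in> carrier_mat (M * r) (N * c)"
    and eq: "\<And>j k a b. j < M \<Longrightarrow> k < N \<Longrightarrow> a < r \<Longrightarrow> b < c \<Longrightarrow>
      A $$ (j * r + a, k * c + b) = B $$ (j * r + a, k * c + b)"
  shows "A = B"
proof (rule eq_matI)
  fix x y assume "x < dim_row B" "y < dim_col B"
  then have xy: "x < M * r" "y < N * c" using assms by auto
  then have "0 < r" "0 < c" by (metis gr0I mult_0_right not_less_zero)+
  then have "A $$ (x div r * r + x mod r, y div c * c + y mod c)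
      = B $$ (x div r * r + x mod r, y div c * c + y mod c)"
    using xy by (intro eq) (auto simp: less_mult_imp_div_less)
  then show "A $$ (x, y) = B $$ (x, y)" by simp
qed (use assms in auto)

lemma block_mat_eqI:
  assumes "\<And>j k. j < M \<Longrightarrow> k < N \<Longrightarrow> f j k = g j k"
  shows "block_mat r c M N f = block_mat r c M N g"
  by (rule eq_matI_blocks[of _ M r N c]) (auto simp: index_block_mat assms)

lemma block_mat_eqD:
  assumes eq: "block_mat r c M N f = block_mat r c M N g" and jk: "j < M" "k < N"
    and "f j k \<in> carrier_mat r c" "g j k \<in> carrier_mat r c"
  shows "f j k = g j k"
proof (rule eq_matI)
  fix a b assume "a < dim_row (g j k)" "b < dim_col (g j k)"
  then show "f j k $$ (a, b) = g j k $$ (a, b)"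
    using index_block_mat[OF jk, of a r b c f] index_block_mat[OF jk, of a r b c g] assms by auto
qed (use assms in auto)

lemma sum_lessThan_mult:
  fixes g :: "nat \<Rightarrow> 'a :: comm_monoid_add"
  shows "(\<Sum>i<K * m. g i) = (\<Sum>l<K. \<Sum>h<m. g (l * m + h))"
proof (induction K)
  case (Suc K)
  have "(\<Sum>i<Suc K * m. g i) = sum g {0..<K * m} + sum g {K * m..<K * m + m}"
    by (simp add: atLeast0LessThan[symmetric] sum.atLeastLessThan_concat add.commute)
  also have "sum g {K * m..<K * m + m} = (\<Sum>h<m. g (K * m + h))"
    using sum.shift_bounds_nat_ivl[of g 0 "K * m" m]
    by (simp add: atLeast0LessThan add.commute)
  finally show ?case using Suc by (simp add: atLeast0LessThan)
qed simp

lemma index_block_mat_mult: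
  assumes jk: "j < M" "k < N" "a < r" "b < c"
    and f: "\<And>l. l < K \<Longrightarrow> f j l \<in> carrier_mat r m"
    and g: "\<And>l. l < K \<Longrightarrow> g l k \<in> carrier_mat m c"
  shows "(block_mat r m M K f * block_mat m c K N g) $$ (j * r + a, k * c + b)
      = (\<Sum>l<K. (f j l * g l k) $$ (a, b))"
proof -
  have "(block_mat r m M K f * block_mat m c K N g) $$ (j * r + a, k * c + b)
      = (\<Sum>l<K. \<Sum>h<m. block_mat r m M K f $$ (j * r + a, l * m + h)
          * block_mat m c K N g $$ (l * m + h, k * c + b))"
    using jk by (subst index_mult_mat_sum[OF block_mat_carrier block_mat_carrier])
      (auto simp: block_index_less sum_lessThan_mult)
  also have "\<dots> = (\<Sum>l<K. \<Sum>h<m. f j l $$ (a, h) * g l k $$ (h, b))"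
    using jk by (intro sum.cong) (auto simp: index_block_mat)
  also have "\<dots> = (\<Sum>l<K. (f j l * g l k) $$ (a, b))"
    using jk f g by (intro sum.cong refl index_mult_mat_sum[symmetric]) auto
  finally show ?thesis .
qed

lemma dim_mat_sum [simp]:
  "dim_row (mat_sum r c f A) = r" "dim_col (mat_sum r c f A) = c"
  by (simp_all add: mat_sum_def)

lemma mat_sum_carrier [simp]: "mat_sum r c f A \<in> carrier_mat r c"
  by (simp add: carrier_matI)

lemma index_mat_sum [simp]:
  "a < r \<Longrightarrow> b < c \<Longrightarrow> mat_sum r c f A $$ (a, b) = (\<Sum>l\<in>A. f l $$ (a, b))"
  by (simp add: mat_sum_def)

lemma block_mat_mult:
  assumes "\<And>j l. j < M \<Longrightarrow> l < K \<Longrightarrow> f j l \<in> carrier_mat r m"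
    and "\<And>l k. l < K \<Longrightarrow> k < N \<Longrightarrow> g l k \<in> carrier_mat m c"
  shows "block_mat r m M K f * block_mat m c K N g
      = block_mat r c M N (\<lambda>j k. mat_sum r c (\<lambda>l. f j l * g l k) {..<K})"
  by (rule eq_matI_blocks[of _ M r N c])
    (auto simp: index_block_mat index_block_mat_mult assms
      intro!: mult_carrier_mat[of _ "M * r" "K * m" _ "N * c"])

lemma block_mat_mult_carrier [simp]:
  "block_mat r m M K f * block_mat m c K N g \<in> carrier_mat (M * r) (N * c)"
  by (rule mult_carrier_mat[OF block_mat_carrier block_mat_carrier])

lemma block_mat_uminus:
  assumes "\<And>j k. j < M \<Longrightarrow> k < N \<Longrightarrow> f j k \<in> carrier_mat r c"
  shows "- block_mat r c M N f = block_mat r c M N (\<lambda>j k. - f j k)"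
proof (rule eq_matI_blocks[of _ M r N c])
  fix j k a b assume "j < M" "k < N" "a < r" "b < c"
  then show "(- block_mat r c M N f) $$ (j * r + a, k * c + b)
      = block_mat r c M N (\<lambda>j k. - f j k) $$ (j * r + a, k * c + b)"
    using assms[of j k] by (simp add: index_block_mat block_index_less)
qed auto

lemma block_mat_minus:
  assumes "\<And>j k. j < M \<Longrightarrow> k < N \<Longrightarrow> f j k \<in> carrier_mat r c"
    and "\<And>j k. j < M \<Longrightarrow> k < N \<Longrightarrow> g j k \<in> carrier_mat r c"
  shows "block_mat r c M N f - block_mat r c M N g = block_mat r c M N (\<lambda>j k. f j k - g j k)"
proof (rule eq_matI_blocks[of _ M r N c])
  fix j k a b assume "j < M" "k < N" "a < r" "b < c"
  then show "(block_mat r c M N f - block_mat r c M N g) $$ (j * r + a, k * c + b)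
      = block_mat r c M N (\<lambda>j k. f j k - g j k) $$ (j * r + a, k * c + b)"
    using assms[of j k] by (simp add: index_block_mat block_index_less)
qed (auto intro!: minus_carrier_mat)

lemma block_mat_smult:
  assumes "\<And>j k. j < M \<Longrightarrow> k < N \<Longrightarrow> f j k \<in> carrier_mat r c"
  shows "z \<cdot>\<^sub>m block_mat r c M N f = block_mat r c M N (\<lambda>j k. z \<cdot>\<^sub>m f j k)"
proof (rule eq_matI_blocks[of _ M r N c])
  fix j k a b assume "j < M" "k < N" "a < r" "b < c"
  then show "(z \<cdot>\<^sub>m block_mat r c M N f) $$ (j * r + a, k * c + b)
      = block_mat r c M N (\<lambda>j k. z \<cdot>\<^sub>m f j k) $$ (j * r + a, k * c + b)"
    using assms[of j k] by (simp add: index_block_mat block_index_less)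
qed auto

lemma block_mat_adjoint:
  assumes "\<And>j k. j < M \<Longrightarrow> k < N \<Longrightarrow> f j k \<in> carrier_mat r c"
  shows "mat_adjoint (block_mat r c M N f) = block_mat c r N M (\<lambda>j k. mat_adjoint (f k j))"
proof (rule eq_matI_blocks[of _ N c M r])
  fix j k a b assume "j < N" "k < M" "a < c" "b < r"
  then show "mat_adjoint (block_mat r c M N f) $$ (j * c + a, k * r + b)
      = block_mat c r N M (\<lambda>j k. mat_adjoint (f k j)) $$ (j * c + a, k * r + b)"
    using assms[of k j] by (simp add: index_block_mat block_index_less mat_adjoint_alt)
qed auto

lemma block_index_eq_iff:
  fixes j k a b r :: nat
  assumes "a < r" "b < r"
  shows "j * r + a = k * r + b \<longleftrightarrow> j = k \<and> a = b"
  using assms by (metis div_mult_self3 div_less mod_less mod_mult_self3 add.commute add_0 not_less_zero)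

lemma block_mat_one: "block_mat r r N N (\<lambda>j k. if j = k then 1\<^sub>m r else 0\<^sub>m r r) = 1\<^sub>m (N * r)"
proof (rule eq_matI_blocks[of _ N r N r])
  fix j k a b assume jk: "j < N" "k < N" and ab: "a < r" "b < r"
  have "j * r + a = k * r + b \<longleftrightarrow> j = k \<and> a = b"
    using ab by (rule block_index_eq_iff)
  then show "block_mat r r N N (\<lambda>j k. if j = k then 1\<^sub>m r else 0\<^sub>m r r) $$ (j * r + a, k * r + b)
      = 1\<^sub>m (N * r) $$ (j * r + a, k * r + b)"
    using jk ab by (auto simp: index_block_mat block_index_less)
qed auto

section \<open>Convolution and block Toeplitz matrices\<close>

text \<open>The coefficient of \<open>z\<^sup>m\<close> in the product of the power series with coefficients \<open>x\<close> and \<open>y\<close>.\<close>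

definition conv :: "nat \<Rightarrow> nat \<Rightarrow> (nat \<Rightarrow> complex mat) \<Rightarrow> (nat \<Rightarrow> complex mat) \<Rightarrow> nat \<Rightarrow> complex mat" where
  "conv r c x y m = mat_sum r c (\<lambda>l. x l * y (m - l)) {..m}"

lemma conv_carrier [simp]: "conv r c x y m \<in> carrier_mat r c"
  by (simp add: conv_def)

lemma S_lower_mult:
  assumes x: "\<And>j. x j \<in> carrier_mat r m" and y: "\<And>j. y j \<in> carrier_mat m c"
  shows "S_lower r m n x * S_lower m c n y = S_lower r c n (conv r c x y)"
proof -
  have entry: "(\<Sum>l<n + 1. ((if l \<le> j then x (j - l) else 0\<^sub>m r m) * (if k \<le> l then y (l - k) else 0\<^sub>m m c)) $$ (a, b))
      = (if k \<le> j then conv r c x y (j - k) else 0\<^sub>m r c) $$ (a, b)"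
    if "j < n + 1" "k < n + 1" "a < r" "b < c" for j k a b
  proof -
    have "(\<Sum>l<n + 1. ((if l \<le> j then x (j - l) else 0\<^sub>m r m) * (if k \<le> l then y (l - k) else 0\<^sub>m m c)) $$ (a, b))
        = (\<Sum>l\<in>{k..j}. (x (j - l) * y (l - k)) $$ (a, b))"
      using that x y by (intro sum.mono_neutral_cong_right)
        (auto simp: left_mult_zero_mat[OF y] right_mult_zero_mat[OF x])
    also have "\<dots> = (if k \<le> j then conv r c x y (j - k) else 0\<^sub>m r c) $$ (a, b)"
    proof (cases "k \<le> j")
      case True
      have "(\<Sum>l\<in>{k..j}. (x (j - l) * y (l - k)) $$ (a, b))
          = (\<Sum>i\<le>j - k. (x i * y (j - k - i)) $$ (a, b))"
        using True by (intro sum.reindex_bij_witness[of _ "\<lambda>i. j - i" "\<lambda>l. j - l"]) auto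
      then show ?thesis using True that by (simp add: conv_def)
    qed (use that in auto)
    finally show ?thesis .
  qed
  show ?thesis unfolding S_lower_def
  proof (rule eq_matI_blocks[OF block_mat_mult_carrier block_mat_carrier])
    fix j k a b assume jk: "j < n + 1" "k < n + 1" "a < r" "b < c"
    show "(block_mat r m (n + 1) (n + 1) (\<lambda>j k. if k \<le> j then x (j - k) else 0\<^sub>m r m) * block_mat m c (n + 1) (n + 1) (\<lambda>j k. if k \<le> j then y (j - k) else 0\<^sub>m m c)) $$ (j * r + a, k * c + b)
        = block_mat r c (n + 1) (n + 1) (\<lambda>j k. if k \<le> j then conv r c x y (j - k) else 0\<^sub>m r c) $$ (j * r + a, k * c + b)"
      unfolding index_block_mat[OF jk]
      by (rule trans, rule index_block_mat_mult[OF jk], use x in force, use y in force, rule entry[OF jk])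
  qed
qed

lemma S_upper_mult:
  assumes x: "\<And>j. x j \<in> carrier_mat r m" and y: "\<And>j. y j \<in> carrier_mat m c"
  shows "S_upper r m n x * S_upper m c n y = S_upper r c n (conv r c x y)"
proof -
  have entry: "(\<Sum>l<n + 1. ((if j \<le> l then x (l - j) else 0\<^sub>m r m) * (if l \<le> k then y (k - l) else 0\<^sub>m m c)) $$ (a, b))
      = (if j \<le> k then conv r c x y (k - j) else 0\<^sub>m r c) $$ (a, b)"
    if "j < n + 1" "k < n + 1" "a < r" "b < c" for j k a b
  proof -
    have "(\<Sum>l<n + 1. ((if j \<le> l then x (l - j) else 0\<^sub>m r m) * (if l \<le> k then y (k - l) else 0\<^sub>m m c)) $$ (a, b))
        = (\<Sum>l\<in>{j..k}. (x (l - j) * y (k - l)) $$ (a, b))"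
      using that x y by (intro sum.mono_neutral_cong_right)
        (auto simp: left_mult_zero_mat[OF y] right_mult_zero_mat[OF x])
    also have "\<dots> = (if j \<le> k then conv r c x y (k - j) else 0\<^sub>m r c) $$ (a, b)"
    proof (cases "j \<le> k")
      case True
      have "(\<Sum>l\<in>{j..k}. (x (l - j) * y (k - l)) $$ (a, b))
          = (\<Sum>i\<le>k - j. (x i * y (k - j - i)) $$ (a, b))"
        using True by (intro sum.reindex_bij_witness[of _ "\<lambda>i. i + j" "\<lambda>l. l - j"]) auto
      then show ?thesis using True that by (simp add: conv_def)
    qed (use that in auto)
    finally show ?thesis .
  qed
  show ?thesis unfolding S_upper_def
  proof (rule eq_matI_blocks[OF block_mat_mult_carrier block_mat_carrier])
    fix j k a b assume jk: "j < n + 1" "k < n + 1" "a < r" "b < c"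
    show "(block_mat r m (n + 1) (n + 1) (\<lambda>j k. if j \<le> k then x (k - j) else 0\<^sub>m r m) * block_mat m c (n + 1) (n + 1) (\<lambda>j k. if j \<le> k then y (k - j) else 0\<^sub>m m c)) $$ (j * r + a, k * c + b)
        = block_mat r c (n + 1) (n + 1) (\<lambda>j k. if j \<le> k then conv r c x y (k - j) else 0\<^sub>m r c) $$ (j * r + a, k * c + b)"
      unfolding index_block_mat[OF jk]
      by (rule trans, rule index_block_mat_mult[OF jk], use x in force, use y in force, rule entry[OF jk])
  qed
qed

text \<open>The lower left corner block of a lower triangular Toeplitz matrix is its last coefficient.\<close>

lemma S_lower_inject:
  assumes "S_lower r c n x = S_lower r c n y" "x n \<in> carrier_mat r c" "y n \<in> carrier_mat r c"
  shows "x n = y n"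
  using block_mat_eqD[OF assms(1)[unfolded S_lower_def], of n 0] assms(2,3) by simp

text \<open>Inherited from the associativity of the matrix product: the Toeplitz matrices multiply like the
sequences, and they determine them.\<close>

lemma conv_assoc:
  assumes x: "\<And>j. x j \<in> carrier_mat r m" and y: "\<And>j. y j \<in> carrier_mat m k"
    and z: "\<And>j. z j \<in> carrier_mat k c"
  shows "conv r c (conv r k x y) z = conv r c x (conv m c y z)"
proof
  fix n
  have "S_lower r c n (conv r c (conv r k x y) z) = S_lower r m n x * S_lower m k n y * S_lower k c n z"
    using x y z by (simp add: S_lower_mult)
  also have "\<dots> = S_lower r m n x * (S_lower m k n y * S_lower k c n z)"
    by (rule mult_mat_assoc) (simp_all add: S_lower_def)
  also have "\<dots> = S_lower r c n (conv r c x (conv m c y z))"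
    using x y z by (simp add: S_lower_mult)
  finally show "conv r c (conv r k x y) z n = conv r c x (conv m c y z) n"
    by (rule S_lower_inject) auto
qed

definition delta :: "complex mat \<Rightarrow> nat \<Rightarrow> complex mat" where
  "delta A j = (if j = 0 then A else 0\<^sub>m (dim_row A) (dim_col A))"

lemma delta_carrier [simp]: "A \<in> carrier_mat r c \<Longrightarrow> delta A j \<in> carrier_mat r c"
  by (auto simp: delta_def)

lemma conv_delta_left:
  assumes A: "A \<in> carrier_mat r m" and x: "\<And>j. x j \<in> carrier_mat m c"
  shows "conv r c (delta A) x = (\<lambda>j. A * x j)"
proof
  fix j
  show "conv r c (delta A) x j = A * x j"
  proof (rule eq_matI)
    fix a b assume "a < dim_row (A * x j)" "b < dim_col (A * x j)"
    then have ab: "a < r" "b < c" using A x[of j] by auto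
    have "conv r c (delta A) x j $$ (a, b) = (\<Sum>l\<le>j. if l = 0 then (A * x j) $$ (a, b) else 0)"
      unfolding conv_def index_mat_sum[OF ab]
      using A ab x by (intro sum.cong) (auto simp: delta_def left_mult_zero_mat[OF x] simp del: index_mult_mat)
    then show "conv r c (delta A) x j $$ (a, b) = (A * x j) $$ (a, b)" by simp
  qed (use A x[of j] in \<open>auto simp: conv_def\<close>)
qed

lemma conv_delta_right:
  assumes A: "A \<in> carrier_mat m c" and x: "\<And>j. x j \<in> carrier_mat r m"
  shows "conv r c x (delta A) = (\<lambda>j. x j * A)"
proof
  fix j
  show "conv r c x (delta A) j = x j * A"
  proof (rule eq_matI)
    fix a b assume "a < dim_row (x j * A)" "b < dim_col (x j * A)"
    then have ab: "a < r" "b < c" using A x[of j] by auto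
    have "conv r c x (delta A) j $$ (a, b) = (\<Sum>l\<le>j. if l = j then (x j * A) $$ (a, b) else 0)"
      unfolding conv_def index_mat_sum[OF ab]
      using A ab x by (intro sum.cong) (auto simp: delta_def right_mult_zero_mat[OF x] simp del: index_mult_mat)
    then show "conv r c x (delta A) j $$ (a, b) = (x j * A) $$ (a, b)" by simp
  qed (use A x[of j] in \<open>auto simp: conv_def\<close>)
qed

lemma mult_mat_sum:
  assumes A: "A \<in> carrier_mat r m" and f: "\<And>l. l \<in> S \<Longrightarrow> f l \<in> carrier_mat m c"
  shows "A * mat_sum m c f S = mat_sum r c (\<lambda>l. A * f l) S"
proof (rule eq_matI)
  fix a b assume "a < dim_row (mat_sum r c (\<lambda>l. A * f l) S)" "b < dim_col (mat_sum r c (\<lambda>l. A * f l) S)"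
  then have ab: "a < r" "b < c" by auto
  have "(A * mat_sum m c f S) $$ (a, b) = (\<Sum>k<m. \<Sum>l\<in>S. A $$ (a, k) * f l $$ (k, b))"
    using A ab by (subst index_mult_mat_sum[of _ r m _ c]) (auto simp: sum_distrib_left)
  also have "\<dots> = (\<Sum>l\<in>S. \<Sum>k<m. A $$ (a, k) * f l $$ (k, b))" by (rule sum.swap)
  also have "\<dots> = (\<Sum>l\<in>S. (A * f l) $$ (a, b))"
    using A ab f by (intro sum.cong refl index_mult_mat_sum[symmetric]) auto
  finally show "(A * mat_sum m c f S) $$ (a, b) = mat_sum r c (\<lambda>l. A * f l) S $$ (a, b)"
    using ab by simp
qed (use A in auto)

lemma mat_sum_mult:
  assumes A: "A \<in> carrier_mat m c" and f: "\<And>l. l \<in> S \<Longrightarrow> f l \<in> carrier_mat r m"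
  shows "mat_sum r m f S * A = mat_sum r c (\<lambda>l. f l * A) S"
proof (rule eq_matI)
  fix a b assume "a < dim_row (mat_sum r c (\<lambda>l. f l * A) S)" "b < dim_col (mat_sum r c (\<lambda>l. f l * A) S)"
  then have ab: "a < r" "b < c" by auto
  have "(mat_sum r m f S * A) $$ (a, b) = (\<Sum>k<m. \<Sum>l\<in>S. f l $$ (a, k) * A $$ (k, b))"
    using A ab by (subst index_mult_mat_sum[of _ r m _ c]) (auto simp: sum_distrib_right)
  also have "\<dots> = (\<Sum>l\<in>S. \<Sum>k<m. f l $$ (a, k) * A $$ (k, b))" by (rule sum.swap)
  also have "\<dots> = (\<Sum>l\<in>S. (f l * A) $$ (a, b))"
    using A ab f by (intro sum.cong refl index_mult_mat_sum[symmetric]) auto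
  finally show "(mat_sum r m f S * A) $$ (a, b) = mat_sum r c (\<lambda>l. f l * A) S $$ (a, b)"
    using ab by simp
qed (use A in auto)

lemma mat_sum_if_left:
  fixes j n :: nat
  assumes "j < n + 1" and Y: "\<And>l. Y l \<in> carrier_mat m c"
  shows "mat_sum r c (\<lambda>l. (if l \<le> j then X l else 0\<^sub>m r m) * Y l) {..<n + 1}
    = mat_sum r c (\<lambda>l. X l * Y l) {..j}"
proof (rule eq_matI)
  fix a b assume "a < dim_row (mat_sum r c (\<lambda>l. X l * Y l) {..j})"
    "b < dim_col (mat_sum r c (\<lambda>l. X l * Y l) {..j})"
  then have ab: "a < r" "b < c" by auto
  show "mat_sum r c (\<lambda>l. (if l \<le> j then X l else 0\<^sub>m r m) * Y l) {..<n + 1} $$ (a, b)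
    = mat_sum r c (\<lambda>l. X l * Y l) {..j} $$ (a, b)"
    unfolding index_mat_sum[OF ab] using assms(1) ab
    by (intro sum.mono_neutral_cong_right) (auto simp: left_mult_zero_mat[OF Y])
qed auto

lemma mat_sum_if_right:
  fixes k n :: nat
  assumes "k < n + 1" and X: "\<And>l. X l \<in> carrier_mat r m"
  shows "mat_sum r c (\<lambda>l. X l * (if l \<le> k then Y l else 0\<^sub>m m c)) {..<n + 1}
    = mat_sum r c (\<lambda>l. X l * Y l) {..k}"
proof (rule eq_matI)
  fix a b assume "a < dim_row (mat_sum r c (\<lambda>l. X l * Y l) {..k})"
    "b < dim_col (mat_sum r c (\<lambda>l. X l * Y l) {..k})"
  then have ab: "a < r" "b < c" by auto
  show "mat_sum r c (\<lambda>l. X l * (if l \<le> k then Y l else 0\<^sub>m m c)) {..<n + 1} $$ (a, b)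
    = mat_sum r c (\<lambda>l. X l * Y l) {..k} $$ (a, b)"
    unfolding index_mat_sum[OF ab] using assms(1) ab
    by (intro sum.mono_neutral_cong_right) (auto simp: right_mult_zero_mat[OF X])
qed auto

text \<open>A vanishing coefficient of a product of power series, split at the index \<open>j\<close>: the terms that a
Toeplitz matrix sees are the negative of the terms that it does not see. All identities between
Hankel matrices below rest on this.\<close>

lemma convolution_tail:
  assumes zero: "conv r c x y (j + d) = 0\<^sub>m r c"
  shows "mat_sum r c (\<lambda>l. x (j - l) * y (l + d)) {..j}
    = - mat_sum r c (\<lambda>i. x (j + i + 1) * y (d - 1 - i)) {..<d}"
proof (rule eq_matI)
  fix a b assume "a < dim_row (- mat_sum r c (\<lambda>i. x (j + i + 1) * y (d - 1 - i)) {..<d})"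
    "b < dim_col (- mat_sum r c (\<lambda>i. x (j + i + 1) * y (d - 1 - i)) {..<d})"
  then have ab: "a < r" "b < c" by auto
  let ?g = "\<lambda>l. (x l * y (j + d - l)) $$ (a, b)"
  have "0 = conv r c x y (j + d) $$ (a, b)" unfolding zero using ab by simp
  also have "\<dots> = (\<Sum>l\<le>j + d. ?g l)" using ab by (simp add: conv_def del: index_mult_mat)
  also have "{..j + d} = {..j} \<union> {j + 1..j + d}" by auto
  also have "sum ?g \<dots> = sum ?g {..j} + sum ?g {j + 1..j + d}"
    by (rule sum.union_disjoint) auto
  also have "sum ?g {..j} = (\<Sum>l\<le>j. (x (j - l) * y (l + d)) $$ (a, b))"
    by (rule sum.reindex_bij_witness[of _ "\<lambda>l. j - l" "\<lambda>l. j - l"])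
      (auto simp: add.commute simp del: index_mult_mat)
  also have "sum ?g {j + 1..j + d} = (\<Sum>i<d. (x (j + i + 1) * y (d - 1 - i)) $$ (a, b))"
    by (rule sum.reindex_bij_witness[of _ "\<lambda>i. j + i + 1" "\<lambda>l. l - j - 1"])
      (auto simp: add.commute[of d j] simp del: index_mult_mat)
  finally show "mat_sum r c (\<lambda>l. x (j - l) * y (l + d)) {..j} $$ (a, b)
      = (- mat_sum r c (\<lambda>i. x (j + i + 1) * y (d - 1 - i)) {..<d}) $$ (a, b)"
    using ab by (simp add: eq_neg_iff_add_eq_0 del: index_mult_mat)
qed auto

lemma mat_sum_lessThan_Suc_shift:
  assumes "f 0 \<in> carrier_mat r c"
  shows "mat_sum r c f {..<Suc k} = f 0 + mat_sum r c (\<lambda>i. f (Suc i)) {..<k}"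
  by (rule eq_matI) (use assms in \<open>auto simp: sum.lessThan_Suc_shift simp del: sum.lessThan_Suc\<close>)

lemma mat_sum_singleton:
  assumes "f 0 \<in> carrier_mat r c"
  shows "mat_sum r c f {..<1::nat} = f 0"
  by (rule eq_matI) (use assms in auto)

lemma S_lower_delta:
  "A \<in> carrier_mat r c \<Longrightarrow>
    S_lower r c n (delta A) = block_mat r c (n + 1) (n + 1) (\<lambda>j k. if j = k then A else 0\<^sub>m r c)"
  unfolding S_lower_def by (rule block_mat_eqI) (auto simp: delta_def)

lemma S_upper_delta:
  "A \<in> carrier_mat r c \<Longrightarrow>
    S_upper r c n (delta A) = block_mat r c (n + 1) (n + 1) (\<lambda>j k. if j = k then A else 0\<^sub>m r c)"
  unfolding S_upper_def by (rule block_mat_eqI) (auto simp: delta_def)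

lemma diag_mult_block_mat:
  assumes A: "A \<in> carrier_mat r m" and f: "\<And>j k. j < M \<Longrightarrow> k < N \<Longrightarrow> f j k \<in> carrier_mat m c"
  shows "block_mat r m M M (\<lambda>j k. if j = k then A else 0\<^sub>m r m) * block_mat m c M N f
    = block_mat r c M N (\<lambda>j k. A * f j k)"
proof (rule eq_matI_blocks[OF block_mat_mult_carrier block_mat_carrier])
  fix j k a b assume jk: "j < M" "k < N" "a < r" "b < c"
  have "(\<Sum>l<M. ((if j = l then A else 0\<^sub>m r m) * f l k) $$ (a, b))
      = (\<Sum>l<M. if l = j then (A * f j k) $$ (a, b) else 0)"
    using jk f by (intro sum.cong) (auto simp: left_mult_zero_mat[OF f] simp del: index_mult_mat)
  then show "(block_mat r m M M (\<lambda>j k. if j = k then A else 0\<^sub>m r m) * block_mat m c M N f) $$ (j * r + a, k * c + b)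
      = block_mat r c M N (\<lambda>j k. A * f j k) $$ (j * r + a, k * c + b)"
    using jk A f by (simp add: index_block_mat_mult index_block_mat del: index_mult_mat)
qed

lemma block_mat_mult_diag:
  assumes A: "A \<in> carrier_mat m c" and f: "\<And>j k. j < M \<Longrightarrow> k < N \<Longrightarrow> f j k \<in> carrier_mat r m"
  shows "block_mat r m M N f * block_mat m c N N (\<lambda>j k. if j = k then A else 0\<^sub>m m c)
    = block_mat r c M N (\<lambda>j k. f j k * A)"
proof (rule eq_matI_blocks[OF block_mat_mult_carrier block_mat_carrier])
  fix j k a b assume jk: "j < M" "k < N" "a < r" "b < c"
  have "(\<Sum>l<N. (f j l * (if l = k then A else 0\<^sub>m m c)) $$ (a, b))
      = (\<Sum>l<N. if l = k then (f j k * A) $$ (a, b) else 0)"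
    using jk f by (intro sum.cong) (auto simp: right_mult_zero_mat[OF f] simp del: index_mult_mat)
  then show "(block_mat r m M N f * block_mat m c N N (\<lambda>j k. if j = k then A else 0\<^sub>m m c)) $$ (j * r + a, k * c + b)
      = block_mat r c M N (\<lambda>j k. f j k * A) $$ (j * r + a, k * c + b)"
    using jk A f by (simp add: index_block_mat_mult index_block_mat del: index_mult_mat)
qed

lemma block_mat_single: "A \<in> carrier_mat r c \<Longrightarrow> block_mat r c 1 1 (\<lambda>j k. A) = A"
  by (rule eq_matI) (auto simp: block_mat_def)

section \<open>Pairs of mutually reciprocal sequences\<close>

text \<open>As power series, \<open>u v\<close> and \<open>v u\<close> are the constants \<open>P = u\<^sub>0 v\<^sub>0\<close> and \<open>Q = v\<^sub>0 u\<^sub>0\<close>, which act as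
units on \<open>u\<close> and \<open>v\<close>. The conditions are symmetric in \<open>u\<close> and \<open>v\<close>, so every fact about the
pair holds with the roles exchanged.\<close>

locale reciprocal_pair =
  fixes p q :: nat and u v :: "nat \<Rightarrow> complex mat"
  assumes u: "\<And>j. u j \<in> carrier_mat p q" and v: "\<And>j. v j \<in> carrier_mat q p"
    and mp: "is_mp_inverse (u 0) (v 0)"
    and uv: "conv p p u v = delta (u 0 * v 0)" and vu: "conv q q v u = delta (v 0 * u 0)"
    and u_range: "\<And>j. u 0 * v 0 * u j = u j" and u_kernel: "\<And>j. u j * (v 0 * u 0) = u j"
    and v_range: "\<And>j. v 0 * u 0 * v j = v j" and v_kernel: "\<And>j. v j * (u 0 * v 0) = v j"
begin

lemma swap: "reciprocal_pair q p v u"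
  by unfold_locales
    (use u v uv vu u_range u_kernel v_range v_kernel is_mp_inverse_sym[OF mp] in auto)

lemma mp_inverse_u0: "mp_inverse (u 0) = v 0"
  by (rule mp_inverse_eqI[OF mp])

lemma P [simp]: "u 0 * v 0 \<in> carrier_mat p p" and Q [simp]: "v 0 * u 0 \<in> carrier_mat q q"
  using u[of 0] v[of 0] by auto

lemma conv_vu_0: "0 < m \<Longrightarrow> conv q q v u m = 0\<^sub>m q q"
  using u[of 0] v[of 0] by (simp add: vu delta_def)

text \<open>Block diagonal matrices with diagonal blocks \<open>P\<close> or \<open>Q\<close> are Hermitian, because \<open>v\<^sub>0\<close> is the
Moore-Penrose inverse of \<open>u\<^sub>0\<close>, and they act as units on \<open>f\<close> and \<open>g\<close>.\<close>

lemma is_mp_inverse_block_mat: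
  assumes AB: "block_mat p q N N f * block_mat q p N N g
      = block_mat p p N N (\<lambda>j k. if j = k then u 0 * v 0 else 0\<^sub>m p p)" (is "?A * ?B = _")
    and BA: "block_mat q p N N g * block_mat p q N N f
      = block_mat q q N N (\<lambda>j k. if j = k then v 0 * u 0 else 0\<^sub>m q q)"
    and f: "\<And>j k. f j k \<in> carrier_mat p q" "\<And>j k. u 0 * v 0 * f j k = f j k"
    and g: "\<And>j k. g j k \<in> carrier_mat q p" "\<And>j k. v 0 * u 0 * g j k = g j k"
  shows "is_mp_inverse ?A ?B"
proof -
  have 1: "?A * ?B * ?A = ?A" and 2: "?B * ?A * ?B = ?B"
    unfolding AB BA using f g by (simp_all only: diag_mult_block_mat[OF P] diag_mult_block_mat[OF Q])
  have adj0: "mat_adjoint (0\<^sub>m k k :: complex mat) = 0\<^sub>m k k" for k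
    by (rule eq_matI) (auto simp: mat_adjoint_alt)
  have 3: "mat_adjoint (?A * ?B) = ?A * ?B"
    unfolding AB using mp
    by (subst block_mat_adjoint) (auto intro!: block_mat_eqI simp: is_mp_inverse_def adj0 P)
  have 4: "mat_adjoint (?B * ?A) = ?B * ?A"
    unfolding BA using mp
    by (subst block_mat_adjoint) (auto intro!: block_mat_eqI simp: is_mp_inverse_def adj0 Q)
  show ?thesis
    unfolding is_mp_inverse_def using 1 2 3 4 by auto
qed

lemma mp_inverse_S_lower: "mp_inverse (S_lower p q n u) = S_lower q p n v"
proof (rule mp_inverse_eqI, unfold S_lower_def, rule is_mp_inverse_block_mat, fold S_lower_def)
  show "S_lower p q n u * S_lower q p n v
      = block_mat p p (n + 1) (n + 1) (\<lambda>j k. if j = k then u 0 * v 0 else 0\<^sub>m p p)"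
    by (simp only: S_lower_mult[OF u v] uv S_lower_delta[OF P])
  show "S_lower q p n v * S_lower p q n u
      = block_mat q q (n + 1) (n + 1) (\<lambda>j k. if j = k then v 0 * u 0 else 0\<^sub>m q q)"
    by (simp only: S_lower_mult[OF v u] vu S_lower_delta[OF Q])
qed (auto simp: u v u_range v_range right_mult_zero_mat[OF P] right_mult_zero_mat[OF Q])

lemma mp_inverse_S_upper: "mp_inverse (S_upper p q n u) = S_upper q p n v"
proof (rule mp_inverse_eqI, unfold S_upper_def, rule is_mp_inverse_block_mat, fold S_upper_def)
  show "S_upper p q n u * S_upper q p n v
      = block_mat p p (n + 1) (n + 1) (\<lambda>j k. if j = k then u 0 * v 0 else 0\<^sub>m p p)"
    by (simp only: S_upper_mult[OF u v] uv S_upper_delta[OF P])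
  show "S_upper q p n v * S_upper p q n u
      = block_mat q q (n + 1) (n + 1) (\<lambda>j k. if j = k then v 0 * u 0 else 0\<^sub>m q q)"
    by (simp only: S_upper_mult[OF v u] vu S_upper_delta[OF Q])
qed (auto simp: u v u_range v_range right_mult_zero_mat[OF P] right_mult_zero_mat[OF Q])

text \<open>Multiplying by \<open>S(v)\<close> turns a Hankel matrix of \<open>u\<close> into one of \<open>v\<close>: the \<open>(j, k)\<close> block on the left
is the head of the coefficient of \<open>z\<^bsup>j+k+1\<^esup>\<close> in \<open>v u\<close>, the one of the product on the right
is its tail.\<close>

lemma S_lower_hankel:
  "S_lower q p n v * block_hankel p q n (\<lambda>m. u (m + 1))
    = - (block_hankel q p n (\<lambda>m. v (m + 1)) * S_upper p q n u)"
proof -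
  have "mat_sum q q (\<lambda>l. (if l \<le> j then v (j - l) else 0\<^sub>m q p) * u (l + k + 1)) {..<n + 1}
      = - mat_sum q q (\<lambda>l. v (j + l + 1) * (if l \<le> k then u (k - l) else 0\<^sub>m p q)) {..<n + 1}"
    if "j < n + 1" "k < n + 1" for j k
    using that convolution_tail[OF conv_vu_0, of j "k + 1"]
    by (simp only: mat_sum_if_left[OF _ u] mat_sum_if_right[OF _ v] add.assoc) (simp add: lessThan_Suc_atMost)
  then show ?thesis
    unfolding S_lower_def S_upper_def block_hankel_def using u v
    by (subst (1 2) block_mat_mult; (subst block_mat_uminus)?) (auto intro!: block_mat_eqI)
qed

text \<open>Here the tail of the coefficient of \<open>z\<^bsup>j+k+2\<^esup>\<close> has one term more than the Toeplitz matrix of \<open>u\<close> can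
absorb. The extra term \<open>v\<^sub>j\<^sub>+\<^sub>1 u\<^sub>k\<^sub>+\<^sub>1\<close> is the block of a product of a column and a row.\<close>

lemma S_lower_G:
  "S_lower q p n v * G_mat p q n u
    = - (block_column q p n (\<lambda>j. v (j + 1)) * block_row p q n (\<lambda>j. u (j + 1)))
      - G_mat q p n v * S_upper p q n u"
proof -
  have "mat_sum q q (\<lambda>l. (if l \<le> j then v (j - l) else 0\<^sub>m q p) * u (l + k + 2)) {..<n + 1}
      = - mat_sum q q (\<lambda>l. v (j + 1) * u (k + 1)) {..<1::nat}
        - mat_sum q q (\<lambda>l. v (j + l + 2) * (if l \<le> k then u (k - l) else 0\<^sub>m p q)) {..<n + 1}"
    if "j < n + 1" "k < n + 1" for j k
  proof -
    have c: "v a * u b \<in> carrier_mat q q" for a b by (rule mult_carrier_mat[OF v u])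
    have "mat_sum q q (\<lambda>l. (if l \<le> j then v (j - l) else 0\<^sub>m q p) * u (l + k + 2)) {..<n + 1}
        = mat_sum q q (\<lambda>l. v (j - l) * u (l + (k + 2))) {..j}"
      using that by (simp only: mat_sum_if_left[OF _ u] add.assoc)
    also have "\<dots> = - mat_sum q q (\<lambda>i. v (j + i + 1) * u (k + 2 - 1 - i)) {..<Suc (k + 1)}"
      using convolution_tail[OF conv_vu_0, of j "k + 2"] by simp
    also have "\<dots> = - (v (j + 1) * u (k + 1)
        + mat_sum q q (\<lambda>i. v (j + i + 2) * u (k - i)) {..<Suc k})"
      using c by (subst mat_sum_lessThan_Suc_shift) auto
    also have "\<dots> = - mat_sum q q (\<lambda>l. v (j + 1) * u (k + 1)) {..<1::nat}
        - mat_sum q q (\<lambda>i. v (j + i + 2) * u (k - i)) {..k}"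
      using c[of "j + 1" "k + 1"] by (intro eq_matI) (auto simp: lessThan_Suc_atMost simp del: index_mult_mat(1))
    also have "mat_sum q q (\<lambda>i. v (j + i + 2) * u (k - i)) {..k}
        = mat_sum q q (\<lambda>l. v (j + l + 2) * (if l \<le> k then u (k - l) else 0\<^sub>m p q)) {..<n + 1}"
      by (rule mat_sum_if_right[OF that(2) v, symmetric])
    finally show ?thesis .
  qed
  then show ?thesis
    unfolding S_lower_def S_upper_def G_mat_def block_hankel_def block_column_def block_row_def using u v
    by (subst (1 2 3) block_mat_mult; (subst block_mat_uminus)?; (subst block_mat_minus)?)
      (auto intro!: block_mat_eqI simp del: One_nat_def)
qed

lemma S_lower_column:
  "S_lower q p n v * block_column p q n (\<lambda>j. u (j + 1)) = - (block_column q p n (\<lambda>j. v (j + 1)) * u 0)"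
proof -
  have "mat_sum q q (\<lambda>l. (if l \<le> j then v (j - l) else 0\<^sub>m q p) * u (l + 1)) {..<n + 1}
      = - mat_sum q q (\<lambda>l. v (j + 1) * u 0) {..<1::nat}" if "j < n + 1" for j
    using that convolution_tail[OF conv_vu_0, of j 1]
    by (simp only: mat_sum_if_left[OF _ u])
      (simp add: mat_sum_singleton mult_carrier_mat[OF v u] flip: One_nat_def)
  then have "S_lower q p n v * block_column p q n (\<lambda>j. u (j + 1))
      = - (block_column q p n (\<lambda>j. v (j + 1)) * block_mat p q 1 1 (\<lambda>j k. u 0))"
    unfolding S_lower_def block_column_def using u v
    by (subst (1 2) block_mat_mult; (subst block_mat_uminus)?)
      (auto intro!: block_mat_eqI simp del: One_nat_def)
  then show ?thesis by (simp only: block_mat_single[OF u])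
qed

end

section \<open>Dimensions and block shifts\<close>

lemma dim_S_lower [simp]: "dim_row (S_lower r c n x) = (n + 1) * r" "dim_col (S_lower r c n x) = (n + 1) * c"
  and dim_S_upper [simp]: "dim_row (S_upper r c n x) = (n + 1) * r" "dim_col (S_upper r c n x) = (n + 1) * c"
  and dim_block_hankel [simp]: "dim_row (block_hankel r c n x) = (n + 1) * r" "dim_col (block_hankel r c n x) = (n + 1) * c"
  and dim_G_mat [simp]: "dim_row (G_mat r c n x) = (n + 1) * r" "dim_col (G_mat r c n x) = (n + 1) * c"
  and dim_block_column [simp]: "dim_row (block_column r c n x) = (n + 1) * r" "dim_col (block_column r c n x) = c"
  and dim_block_row [simp]: "dim_row (block_row r c n x) = r" "dim_col (block_row r c n x) = (n + 1) * c"
  by (simp_all add: S_lower_def S_upper_def block_hankel_def G_mat_def block_column_def block_row_def)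

lemma dim_Lambda_Suc [simp]:
  "dim_row (Lambda_Suc r c n x) = (n + 1) * r" "dim_col (Lambda_Suc r c n x) = (n + 1) * c"
  by (simp_all add: Lambda_Suc_def)

lemma block_mat_shift_mult:
  assumes f: "\<And>j k. j < M + 1 \<Longrightarrow> k < N \<Longrightarrow> f j k \<in> carrier_mat r c"
  shows "block_mat r r M (M + 1) (\<lambda>j k. if k = j + 1 then 1\<^sub>m r else 0\<^sub>m r r) * block_mat r c (M + 1) N f
    = block_mat r c M N (\<lambda>j k. f (j + 1) k)"
proof (rule eq_matI_blocks[OF block_mat_mult_carrier block_mat_carrier])
  fix j k a b assume jk: "j < M" "k < N" "a < r" "b < c"
  have "(block_mat r r M (M + 1) (\<lambda>j k. if k = j + 1 then 1\<^sub>m r else 0\<^sub>m r r) * block_mat r c (M + 1) N f)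
      $$ (j * r + a, k * c + b)
      = (\<Sum>l<M + 1. ((if l = j + 1 then 1\<^sub>m r else 0\<^sub>m r r) * f l k) $$ (a, b))"
    by (rule index_block_mat_mult[OF jk]) (use f jk in auto)
  also have "\<dots> = (\<Sum>l<M + 1. if l = j + 1 then f (j + 1) k $$ (a, b) else 0)"
  proof (intro sum.cong refl)
    fix l assume "l \<in> {..<M + 1}"
    then have "f l k \<in> carrier_mat r c" using f jk by auto
    then show "((if l = j + 1 then 1\<^sub>m r else 0\<^sub>m r r) * f l k) $$ (a, b)
        = (if l = j + 1 then f (j + 1) k $$ (a, b) else 0)"
      using jk by (auto simp: left_mult_zero_mat left_mult_one_mat simp del: index_mult_mat(1))
  qed
  finally show "(block_mat r r M (M + 1) (\<lambda>j k. if k = j + 1 then 1\<^sub>m r else 0\<^sub>m r r) * block_mat r c (M + 1) N f)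
      $$ (j * r + a, k * c + b) = block_mat r c M N (\<lambda>j k. f (j + 1) k) $$ (j * r + a, k * c + b)"
    using jk by (simp add: index_block_mat del: sum.lessThan_Suc)
qed

lemma block_mat_mult_shift:
  assumes f: "\<And>j k. j < M \<Longrightarrow> k < N + 1 \<Longrightarrow> f j k \<in> carrier_mat r c"
  shows "block_mat r c M (N + 1) f * block_mat c c (N + 1) N (\<lambda>j k. if j = k + 1 then 1\<^sub>m c else 0\<^sub>m c c)
    = block_mat r c M N (\<lambda>j k. f j (k + 1))"
proof (rule eq_matI_blocks[OF block_mat_mult_carrier block_mat_carrier])
  fix j k a b assume jk: "j < M" "k < N" "a < r" "b < c"
  have "(block_mat r c M (N + 1) f * block_mat c c (N + 1) N (\<lambda>j k. if j = k + 1 then 1\<^sub>m c else 0\<^sub>m c c))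
      $$ (j * r + a, k * c + b)
      = (\<Sum>l<N + 1. (f j l * (if l = k + 1 then 1\<^sub>m c else 0\<^sub>m c c)) $$ (a, b))"
    by (rule index_block_mat_mult[OF jk]) (use f jk in auto)
  also have "\<dots> = (\<Sum>l<N + 1. if l = k + 1 then f j (k + 1) $$ (a, b) else 0)"
  proof (intro sum.cong refl)
    fix l assume "l \<in> {..<N + 1}"
    then have "f j l \<in> carrier_mat r c" using f jk by auto
    then show "(f j l * (if l = k + 1 then 1\<^sub>m c else 0\<^sub>m c c)) $$ (a, b)
        = (if l = k + 1 then f j (k + 1) $$ (a, b) else 0)"
      using jk by (auto simp: right_mult_zero_mat right_mult_one_mat simp del: index_mult_mat(1))
  qed
  finally show "(block_mat r c M (N + 1) f * block_mat c c (N + 1) N (\<lambda>j k. if j = k + 1 then 1\<^sub>m c else 0\<^sub>m c c))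
      $$ (j * r + a, k * c + b) = block_mat r c M N (\<lambda>j k. f j (k + 1)) $$ (j * r + a, k * c + b)"
    using jk by (simp add: index_block_mat del: sum.lessThan_Suc)
qed

lemma nabla_mat_block:
  "nabla_mat r N = block_mat r r (N + 1) N (\<lambda>j k. if j = k + 1 then 1\<^sub>m r else 0\<^sub>m r r)"
proof (rule eq_matI_blocks[of _ "N + 1" r N r])
  fix j k a b assume jk: "j < N + 1" "k < N" and ab: "a < r" "b < r"
  have kb: "k * r + b < N * r" using jk ab by (intro block_index_less) auto
  show "nabla_mat r N $$ (j * r + a, k * r + b)
      = block_mat r r (N + 1) N (\<lambda>j k. if j = k + 1 then 1\<^sub>m r else 0\<^sub>m r r) $$ (j * r + a, k * r + b)"
  proof (cases j)
    case 0
    have "nabla_mat r N $$ (j * r + a, k * r + b) = 0"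
      using 0 ab kb by (simp add: nabla_mat_def append_rows_def)
    also have "\<dots> = (if j = k + 1 then 1\<^sub>m r else 0\<^sub>m r r) $$ (a, b)" using 0 ab by simp
    finally show ?thesis by (simp only: index_block_mat[OF jk ab])
  next
    case (Suc i)
    have ia: "i * r + a < N * r" using Suc jk ab by (intro block_index_less) auto
    have "nabla_mat r N $$ (j * r + a, k * r + b) = 1\<^sub>m (N * r) $$ (i * r + a, k * r + b)"
      using Suc ia kb by (simp add: nabla_mat_def append_rows_def)
    also have "\<dots> = (if i = k then 1\<^sub>m r else 0\<^sub>m r r) $$ (a, b)"
      using ia kb ab by (auto simp: block_index_eq_iff)
    also have "\<dots> = (if j = k + 1 then 1\<^sub>m r else 0\<^sub>m r r) $$ (a, b)" using Suc by simp
    finally show ?thesis by (simp only: index_block_mat[OF jk ab])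
  qed
qed (auto simp: nabla_mat_def append_rows_def)

lemma adjoint_nabla_mat_block:
  "mat_adjoint (nabla_mat r N) = block_mat r r N (N + 1) (\<lambda>j k. if k = j + 1 then 1\<^sub>m r else 0\<^sub>m r r)"
proof -
  have "mat_adjoint (0\<^sub>m r r :: complex mat) = 0\<^sub>m r r" "mat_adjoint (1\<^sub>m r :: complex mat) = 1\<^sub>m r"
    by (auto simp: mat_adjoint_alt)
  then show ?thesis
    unfolding nabla_mat_block by (subst block_mat_adjoint) (auto intro!: block_mat_eqI)
qed

section \<open>Hankel matrices of a reciprocal pair\<close>

context reciprocal_pair
begin

lemma mult_S_upper_delta:
  assumes "\<And>j k. j < n + 1 \<Longrightarrow> k < n + 1 \<Longrightarrow> f j k * (u 0 * v 0) = f j k"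
    and "\<And>j k. j < n + 1 \<Longrightarrow> k < n + 1 \<Longrightarrow> f j k \<in> carrier_mat q p"
  shows "block_mat q p (n + 1) (n + 1) f * S_upper p p n (delta (u 0 * v 0))
    = block_mat q p (n + 1) (n + 1) f"
  using assms by (simp only: S_upper_delta[OF P] block_mat_mult_diag[OF P]) (auto intro: block_mat_eqI)

lemma P_mult_row: "u 0 * v 0 * block_row p q n (\<lambda>j. u (j + 1)) = block_row p q n (\<lambda>j. u (j + 1))"
proof -
  have "u 0 * v 0 * block_row p q n (\<lambda>j. u (j + 1))
      = block_mat p p 1 1 (\<lambda>j k. if j = k then u 0 * v 0 else 0\<^sub>m p p) * block_row p q n (\<lambda>j. u (j + 1))"
    by (subst block_mat_single[OF P, symmetric]) (auto intro!: arg_cong2[where f = "(*)"] block_mat_eqI)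
  also have "\<dots> = block_row p q n (\<lambda>j. u (j + 1))"
    unfolding block_row_def using u by (subst diag_mult_block_mat) (auto simp: u_range)
  finally show ?thesis .
qed

text \<open>The Schur complement \<open>\<Lambda>(u)\<close> subtracts exactly what is needed: the correction term of
\<open>S(v) G(u)\<close> cancels against \<open>S(v)\<close> times the product of column, \<open>v\<^sub>0\<close> and row, since
\<open>S(v)\<close> times the column of \<open>u\<close> is the negative column of \<open>v\<close> times \<open>u\<^sub>0\<close>, and \<open>u\<^sub>0 v\<^sub>0\<close> fixes the row.\<close>

lemma S_lower_Lambda: "S_lower q p n v * Lambda_Suc p q n u = - (G_mat q p n v * S_upper p q n u)"
proof -
  let ?N = "n + 1"
  define Sv where "Sv = S_lower q p n v"
  define Gu where "Gu = G_mat p q n u"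
  define cu where "cu = block_column p q n (\<lambda>j. u (j + 1))"
  define ru where "ru = block_row p q n (\<lambda>j. u (j + 1))"
  define cv where "cv = block_column q p n (\<lambda>j. v (j + 1))"
  define X where "X = G_mat q p n v * S_upper p q n u"
  have c: "Sv \<in> carrier_mat (?N * q) (?N * p)" "Gu \<in> carrier_mat (?N * p) (?N * q)"
    "cu \<in> carrier_mat (?N * p) q" "ru \<in> carrier_mat p (?N * q)" "cv \<in> carrier_mat (?N * q) p"
    "X \<in> carrier_mat (?N * q) (?N * q)"
    by (auto simp: Sv_def Gu_def cu_def ru_def cv_def X_def intro: carrier_matI)
  have u0: "u 0 \<in> carrier_mat p q" and v0: "v 0 \<in> carrier_mat q p" by (rule u, rule v)
  have "Sv * (cu * v 0 * ru) = (Sv * cu) * (v 0 * ru)" using c v0 by (simp add: mult_mat_assoc)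
  also have "\<dots> = - (cv * u 0) * (v 0 * ru)"
    unfolding Sv_def cu_def cv_def by (simp only: S_lower_column)
  also have "\<dots> = - (cv * (u 0 * v 0 * ru))" using c u0 v0 by (simp add: mult_mat_assoc)
  also have "u 0 * v 0 * ru = ru" unfolding ru_def by (rule P_mult_row)
  finally have 1: "Sv * (cu * v 0 * ru) = - (cv * ru)" .
  have 2: "Sv * Gu = - (cv * ru) - X"
    unfolding Sv_def Gu_def cv_def ru_def X_def by (rule S_lower_G)
  have "Sv * (Gu - cu * v 0 * ru) = Sv * Gu - Sv * (cu * v 0 * ru)"
    using c v0 by (intro mult_minus_distrib_mat) auto
  also have "\<dots> = - X" unfolding 1 2 using c by (intro eq_matI) (auto simp del: index_mult_mat(1))
  finally show ?thesis
    by (simp add: Sv_def Gu_def cu_def ru_def X_def Lambda_Suc_def mp_inverse_u0)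
qed

lemma G_mult_P: "G_mat q p n v * S_upper p p n (delta (u 0 * v 0)) = G_mat q p n v"
  unfolding G_mat_def block_hankel_def by (rule mult_S_upper_delta) (auto simp: v v_kernel)

lemma G_eq_Lambda:
  "G_mat q p n v = - (S_lower q p n v * Lambda_Suc p q n u * S_upper q p n v)"
proof -
  have "S_lower q p n v * Lambda_Suc p q n u * S_upper q p n v
      = - (G_mat q p n v * (S_upper p q n u * S_upper q p n v))"
    unfolding S_lower_Lambda by (simp add: mult_mat_assoc)
  also have "S_upper p q n u * S_upper q p n v = S_upper p p n (delta (u 0 * v 0))"
    by (simp add: S_upper_mult[OF u v] uv)
  finally show ?thesis by (simp add: G_mult_P)
qed

lemma hankel_eq:
  "S_lower q p n v * block_hankel p q n (\<lambda>m. u (m + 1)) * S_upper q p n v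
    = - block_hankel q p n (\<lambda>m. v (m + 1))"
proof -
  have "S_lower q p n v * block_hankel p q n (\<lambda>m. u (m + 1)) * S_upper q p n v
      = - (block_hankel q p n (\<lambda>m. v (m + 1)) * (S_upper p q n u * S_upper q p n v))"
    unfolding S_lower_hankel by (simp add: mult_mat_assoc)
  also have "S_upper p q n u * S_upper q p n v = S_upper p p n (delta (u 0 * v 0))"
    by (simp add: S_upper_mult[OF u v] uv)
  also have "block_hankel q p n (\<lambda>m. v (m + 1)) * S_upper p p n (delta (u 0 * v 0))
      = block_hankel q p n (\<lambda>m. v (m + 1))"
    unfolding block_hankel_def by (rule mult_S_upper_delta) (auto simp: v v_kernel)
  finally show ?thesis .
qed

text \<open>The full Hankel matrix of \<open>u\<close> between the larger Toeplitz matrices of \<open>v\<close> is block diagonal with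
blocks \<open>v\<^sub>0\<close> and \<open>- G(v)\<close>; the matrices \<open>\<nabla>\<close> cut out the second block. Only the rows and columns
that survive are computed: \<open>A\<close> and \<open>B\<close> are the cut Toeplitz matrices of \<open>v\<close>, and \<open>E\<close> is the
Toeplitz matrix of \<open>u\<close> with a zero block column in front.\<close>

lemma nabla_hankel_eq:
  "mat_adjoint (nabla_mat q (n + 1)) * S_lower q p (n + 1) v * block_hankel p q (n + 1) u
      * S_upper q p (n + 1) v * nabla_mat p (n + 1) = - G_mat q p n v"
proof -
  define A where "A = block_mat q p (n + 1) (n + 1 + 1) (\<lambda>j l. if l \<le> j + 1 then v (j + 1 - l) else 0\<^sub>m q p)"
  define B where "B = block_mat q p (n + 1 + 1) (n + 1) (\<lambda>l k. if l \<le> k + 1 then v (k + 1 - l) else 0\<^sub>m q p)"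
  define E where "E = block_mat p q (n + 1) (n + 1 + 1) (\<lambda>j k. if j + 1 \<le> k then u (k - 1 - j) else 0\<^sub>m p q)"
  let ?H = "block_hankel p q (n + 1) u"
  have A: "mat_adjoint (nabla_mat q (n + 1)) * S_lower q p (n + 1) v = A"
    unfolding adjoint_nabla_mat_block S_lower_def A_def using v
    by (subst block_mat_shift_mult) (auto intro!: block_mat_eqI simp: numeral_2_eq_2)
  have B: "S_upper q p (n + 1) v * nabla_mat p (n + 1) = B"
    unfolding nabla_mat_block S_upper_def B_def using v
    by (subst block_mat_mult_shift) (auto intro!: block_mat_eqI simp: numeral_2_eq_2)
  have AH: "A * ?H = - (G_mat q p n v * E)"
  proof -
    have "mat_sum q q (\<lambda>l. (if l \<le> j + 1 then v (j + 1 - l) else 0\<^sub>m q p) * u (l + k)) {..<n + 1 + 1}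
        = - mat_sum q q (\<lambda>l. v (j + l + 2) * (if l + 1 \<le> k then u (k - 1 - l) else 0\<^sub>m p q)) {..<n + 1}"
      if jk: "j < n + 1" "k < n + 1 + 1" for j k
    proof -
      have "mat_sum q q (\<lambda>l. (if l \<le> j + 1 then v (j + 1 - l) else 0\<^sub>m q p) * u (l + k)) {..<n + 1 + 1}
          = mat_sum q q (\<lambda>l. v (j + 1 - l) * u (l + k)) {..j + 1}"
        using jk u by (intro mat_sum_if_left) auto
      also have "\<dots> = - mat_sum q q (\<lambda>i. v (j + 1 + i + 1) * u (k - 1 - i)) {..<k}"
        by (rule convolution_tail[OF conv_vu_0]) simp
      also have "mat_sum q q (\<lambda>i. v (j + 1 + i + 1) * u (k - 1 - i)) {..<k}
          = mat_sum q q (\<lambda>l. v (j + l + 2) * (if l + 1 \<le> k then u (k - 1 - l) else 0\<^sub>m p q)) {..<n + 1}"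
      proof (rule eq_matI)
        fix a b assume "a < dim_row (mat_sum q q (\<lambda>l. v (j + l + 2) * (if l + 1 \<le> k then u (k - 1 - l) else 0\<^sub>m p q)) {..<n + 1})"
          "b < dim_col (mat_sum q q (\<lambda>l. v (j + l + 2) * (if l + 1 \<le> k then u (k - 1 - l) else 0\<^sub>m p q)) {..<n + 1})"
        then have ab: "a < q" "b < q" by auto
        show "mat_sum q q (\<lambda>i. v (j + 1 + i + 1) * u (k - 1 - i)) {..<k} $$ (a, b)
          = mat_sum q q (\<lambda>l. v (j + l + 2) * (if l + 1 \<le> k then u (k - 1 - l) else 0\<^sub>m p q)) {..<n + 1} $$ (a, b)"
          unfolding index_mat_sum[OF ab] using jk ab
          by (intro sum.mono_neutral_cong_left) (auto simp: right_mult_zero_mat[OF v] simp del: index_mult_mat(1))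
      qed auto
      finally show ?thesis .
    qed
    then show ?thesis
      unfolding A_def block_hankel_def E_def G_mat_def using u v
      by (subst (1 2) block_mat_mult[of "n + 1"]; (subst block_mat_uminus)?)
        (auto intro!: block_mat_eqI simp: numeral_2_eq_2)
  qed
  have EB: "E * B = S_upper p p n (delta (u 0 * v 0))"
  proof -
    have "mat_sum p p (\<lambda>l. (if j + 1 \<le> l then u (l - 1 - j) else 0\<^sub>m p q)
          * (if l \<le> k + 1 then v (k + 1 - l) else 0\<^sub>m q p)) {..<n + 1 + 1}
        = (if j \<le> k then conv p p u v (k - j) else 0\<^sub>m p p)" if jk: "j < n + 1" "k < n + 1" for j k
    proof (rule eq_matI)
      fix a b assume "a < dim_row (if j \<le> k then conv p p u v (k - j) else 0\<^sub>m p p)"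
        "b < dim_col (if j \<le> k then conv p p u v (k - j) else 0\<^sub>m p p)"
      then have ab: "a < p" "b < p" by (auto simp: conv_def split: if_splits)
      have "(\<Sum>l<n + 1 + 1. ((if j + 1 \<le> l then u (l - 1 - j) else 0\<^sub>m p q)
          * (if l \<le> k + 1 then v (k + 1 - l) else 0\<^sub>m q p)) $$ (a, b))
        = (\<Sum>l\<in>{j + 1..k + 1}. (u (l - 1 - j) * v (k + 1 - l)) $$ (a, b))"
        using jk ab by (intro sum.mono_neutral_cong_right)
          (auto simp: left_mult_zero_mat[OF v] right_mult_zero_mat[OF u] simp del: index_mult_mat(1))
      also have "\<dots> = (if j \<le> k then conv p p u v (k - j) else 0\<^sub>m p p) $$ (a, b)"
      proof (cases "j \<le> k")
        case True
        have "(\<Sum>l\<in>{j + 1..k + 1}. (u (l - 1 - j) * v (k + 1 - l)) $$ (a, b))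
            = (\<Sum>i\<le>k - j. (u i * v (k - j - i)) $$ (a, b))"
          using True by (intro sum.reindex_bij_witness[of _ "\<lambda>i. j + 1 + i" "\<lambda>l. l - 1 - j"])
            (auto simp del: index_mult_mat(1))
        then show ?thesis using True ab by (simp add: conv_def del: index_mult_mat(1))
      qed (use ab in auto)
      finally show "mat_sum p p (\<lambda>l. (if j + 1 \<le> l then u (l - 1 - j) else 0\<^sub>m p q)
          * (if l \<le> k + 1 then v (k + 1 - l) else 0\<^sub>m q p)) {..<n + 1 + 1} $$ (a, b)
        = (if j \<le> k then conv p p u v (k - j) else 0\<^sub>m p p) $$ (a, b)"
        unfolding index_mat_sum[OF ab] .
    qed (auto simp: conv_def)
    then show ?thesis
      unfolding E_def B_def S_upper_def uv[symmetric] using u v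
      by (subst block_mat_mult) (auto intro!: block_mat_eqI)
  qed
  have dims: "dim_col A = (n + 1 + 1) * p" "dim_row E = (n + 1) * p" "dim_col E = (n + 1 + 1) * q"
    "dim_row B = (n + 1 + 1) * q"
    by (simp_all add: A_def B_def E_def)
  have "mat_adjoint (nabla_mat q (n + 1)) * S_lower q p (n + 1) v * ?H * S_upper q p (n + 1) v
        * nabla_mat p (n + 1)
      = mat_adjoint (nabla_mat q (n + 1)) * S_lower q p (n + 1) v * ?H * (S_upper q p (n + 1) v * nabla_mat p (n + 1))"
    by (rule mult_mat_assoc) (simp_all add: nabla_mat_block)
  also have "\<dots> = - (G_mat q p n v * E) * B" unfolding A B AH ..
  also have "\<dots> = - (G_mat q p n v * (E * B))" using dims by (simp add: mult_mat_assoc)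
  also have "\<dots> = - G_mat q p n v" unfolding EB G_mult_P ..
  finally show ?thesis .
qed

end

section \<open>The reciprocal sequence of a dominated sequence\<close>

lemma mat_add_eq_selfD:
  fixes A B :: "complex mat"
  assumes "A + B = A" "A \<in> carrier_mat r c" "B \<in> carrier_mat r c"
  shows "B = 0\<^sub>m r c"
proof (rule eq_matI)
  fix a b assume "a < dim_row (0\<^sub>m r c :: complex mat)" "b < dim_col (0\<^sub>m r c :: complex mat)"
  then have ab: "a < r" "b < c" by auto
  have "(A + B) $$ (a, b) = A $$ (a, b)" unfolding assms(1) ..
  then show "B $$ (a, b) = 0\<^sub>m r c $$ (a, b)" using ab assms(2,3) by simp
qed (use assms in auto)

lemma mat_sum_lessThan_Suc:
  "f k \<in> carrier_mat r c \<Longrightarrow> mat_sum r c f {..<Suc k} = mat_sum r c f {..<k} + f k"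
  by (rule eq_matI) auto

lemma conv_flip: "conv r c x y m = mat_sum r c (\<lambda>l. x (m - l) * y l) {..m}"
proof (rule eq_matI)
  fix a b assume "a < dim_row (mat_sum r c (\<lambda>l. x (m - l) * y l) {..m})"
    "b < dim_col (mat_sum r c (\<lambda>l. x (m - l) * y l) {..m})"
  then have ab: "a < r" "b < c" by auto
  show "conv r c x y m $$ (a, b) = mat_sum r c (\<lambda>l. x (m - l) * y l) {..m} $$ (a, b)"
    unfolding conv_def index_mat_sum[OF ab]
    by (rule sum.reindex_bij_witness[of _ "\<lambda>l. m - l" "\<lambda>l. m - l"]) (auto simp del: index_mult_mat)
qed (auto simp: conv_def)

lemma conv_0: "x 0 * y 0 \<in> carrier_mat r c \<Longrightarrow> conv r c x y 0 = x 0 * y 0"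
  by (rule eq_matI) (auto simp: conv_def simp del: index_mult_mat)

text \<open>The recursion says that \<open>v\<close> is a right inverse: in \<open>u v\<close>, the coefficient of positive index is
\<open>B - P B\<close> with the sum \<open>B\<close> of the recursion, and \<open>P B = B\<close>. For the left inverse, put \<open>C = v u\<close>.
Then \<open>C v = v P = v\<close> and \<open>C\<^sub>0 = Q\<close>, so comparing coefficients shows inductively that the later
coefficients satisfy \<open>C\<^sub>m v\<^sub>0 = 0\<close>, whence \<open>C\<^sub>m = C\<^sub>m Q = C\<^sub>m v\<^sub>0 u\<^sub>0 = 0\<close>.\<close>

lemma reciprocal_pair_reciprocal_seq:
  assumes u: "\<And>j. u j \<in> carrier_mat p q"
    and u_range: "\<And>j. u 0 * mp_inverse (u 0) * u j = u j"
    and u_kernel: "\<And>j. u j * (mp_inverse (u 0) * u 0) = u j"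
  shows "reciprocal_pair p q u (reciprocal_seq u)"
proof -
  define v where "v = reciprocal_seq u"
  define U X where "U = u 0" and "X = mp_inverse (u 0)"
  have U: "U \<in> carrier_mat p q" by (simp add: U_def u)
  have mp: "is_mp_inverse U X" unfolding U_def X_def by (rule is_mp_inverse_mp_inverse)
  have X: "X \<in> carrier_mat q p" using mp U by (auto simp: is_mp_inverse_def)
  have dims: "dim_row U = p" "dim_col U = q" "dim_row X = q" "dim_col X = p" using U X by auto
  have XUX: "X * (U * X) = X" using mp dims by (simp add: is_mp_inverse_def mult_mat_assoc)
  let ?P = "U * X" and ?Q = "X * U"
  have P: "?P \<in> carrier_mat p p" and Q: "?Q \<in> carrier_mat q q" using U X by auto
  define B where "B j = mat_sum p p (\<lambda>l. u (Suc j - l) * v l) {..<Suc j}" for j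
  have v0: "v 0 = X" by (simp add: v_def X_def)
  have vSuc: "v (Suc j) = - (X * B j)" for j
    using u[of 0] by (simp add: v_def X_def B_def)
  have B: "B j \<in> carrier_mat p p" for j by (simp add: B_def)
  have v: "v j \<in> carrier_mat q p" for j
    by (cases j) (use X B in \<open>auto simp: v0 vSuc\<close>)
  have uv_c: "u i * v l \<in> carrier_mat p p" for i l by (rule mult_carrier_mat[OF u v])
  have v_range: "?Q * v j = v j" for j
  proof (cases j)
    case 0
    then show ?thesis using dims XUX by (simp add: v0 mult_mat_assoc)
  next
    case (Suc i)
    have "?Q * (X * B i) = X * (U * X) * B i" using dims B[of i] by (simp add: mult_mat_assoc)
    then show ?thesis using Suc dims by (simp add: vSuc XUX)
  qed
  have v_kernel: "v j * ?P = v j" for j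
  proof (induction j rule: less_induct)
    case (less j)
    show ?case
    proof (cases j)
      case 0
      then show ?thesis by (simp add: v0 XUX)
    next
      case (Suc i)
      have "B i * ?P = mat_sum p p (\<lambda>l. u (Suc i - l) * v l * ?P) {..<Suc i}"
        unfolding B_def by (rule mat_sum_mult[OF P]) (rule uv_c)
      also have "\<dots> = B i" unfolding B_def
      proof (rule mat_sum_cong)
        fix l assume "l \<in> {..<Suc i}"
        then have "v l * ?P = v l" using less Suc by auto
        then show "u (Suc i - l) * v l * ?P = u (Suc i - l) * v l"
          using u[of "Suc i - l"] v[of l] P by (simp add: assoc_mult_mat[of _ p q _ p])
      qed auto
      finally have "B i * ?P = B i" .
      then have "X * B i * ?P = X * B i" using X B P by (simp add: assoc_mult_mat[of _ q p _ p])
      then show ?thesis using Suc X B[of i] P dims by (simp add: vSuc)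
    qed
  qed
  have PB: "?P * B j = B j" for j
  proof -
    have "?P * B j = mat_sum p p (\<lambda>l. ?P * (u (Suc j - l) * v l)) {..<Suc j}"
      unfolding B_def by (rule mult_mat_sum[OF P]) (rule uv_c)
    also have "\<dots> = B j" unfolding B_def
    proof (rule mat_sum_cong)
      fix l
      have "?P * (u (Suc j - l) * v l) = ?P * u (Suc j - l) * v l"
        using P u v by (metis assoc_mult_mat)
      then show "?P * (u (Suc j - l) * v l) = u (Suc j - l) * v l"
        by (simp only: u_range[folded U_def X_def])
    qed auto
    finally show ?thesis .
  qed
  have uv: "conv p p u v = delta ?P"
  proof
    fix m show "conv p p u v m = delta ?P m"
    proof (cases m)
      case 0
      then show ?thesis using uv_c[of 0 0] by (simp add: conv_0 delta_def U_def v0)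
    next
      case (Suc j)
      have "conv p p u v m = B j + U * v (Suc j)"
        unfolding conv_flip B_def Suc lessThan_Suc_atMost[symmetric]
        using mat_sum_lessThan_Suc[of "\<lambda>l. u (Suc j - l) * v l" "Suc j" p p] uv_c by (simp add: U_def)
      also have "U * v (Suc j) = - (?P * B j)" using dims B[of j] by (simp add: vSuc mult_mat_assoc)
      also have "B j + - (?P * B j) = 0\<^sub>m p p" unfolding PB using B[of j] by (intro eq_matI) auto
      finally show ?thesis using Suc dims by (simp add: delta_def)
    qed
  qed
  define C where "C = conv q q v u"
  have C: "C j \<in> carrier_mat q q" for j by (simp add: C_def)
  have C0: "C 0 = ?Q"
    using Q by (simp add: C_def conv_0 v0 U_def)
  have Cv: "conv q p C v = v"
    unfolding C_def by (simp add: conv_assoc[OF v u v] uv conv_delta_right[OF P v] v_kernel)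
  have CQ: "C m * ?Q = C m" for m
  proof -
    have "conv q q C (delta ?Q) = conv q q v (conv p q u (delta ?Q))"
      unfolding C_def by (rule conv_assoc[OF v u]) (use Q in simp)
    also have "conv p q u (delta ?Q) = u"
      by (simp add: conv_delta_right[OF Q u] u_kernel[folded U_def X_def])
    finally show ?thesis using fun_cong[of _ _ m] by (simp add: conv_delta_right[OF Q C] C_def[symmetric] fun_eq_iff)
  qed
  have C_Suc: "C (Suc m) = 0\<^sub>m q q" for m
  proof (induction m rule: less_induct)
    case (less m)
    let ?n = "Suc m"
    have zero: "C (Suc l) * v (m - l) = 0\<^sub>m q p" if "l < m" for l
      using less[OF that] by (simp add: left_mult_zero_mat[OF v])
    have c: "C l * v k \<in> carrier_mat q p" for l k by (rule mult_carrier_mat[OF C v])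
    have "v ?n = conv q p C v ?n" by (simp only: Cv)
    also have "\<dots> = mat_sum q p (\<lambda>l. C l * v (?n - l)) {..<Suc m} + C ?n * v 0"
      using mat_sum_lessThan_Suc[of "\<lambda>l. C l * v (?n - l)" ?n q p] c
      by (simp add: conv_def lessThan_Suc_atMost[symmetric] del: lessThan_Suc_atMost)
    also have "mat_sum q p (\<lambda>l. C l * v (?n - l)) {..<Suc m}
        = C 0 * v ?n + mat_sum q p (\<lambda>i. C (Suc i) * v (?n - Suc i)) {..<m}"
      using c by (subst mat_sum_lessThan_Suc_shift) auto
    also have "mat_sum q p (\<lambda>i. C (Suc i) * v (?n - Suc i)) {..<m} = 0\<^sub>m q p"
      by (rule eq_matI) (use zero in \<open>auto simp del: index_mult_mat(1)\<close>)
    finally have "v ?n = v ?n + C ?n * v 0" using v[of ?n] by (simp add: C0 v_range)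
    then have "C ?n * v 0 = 0\<^sub>m q p" by (rule mat_add_eq_selfD[OF sym v c])
    then have "C ?n * X * U = 0\<^sub>m q q" using U by (simp add: v0)
    then show ?case using CQ[of ?n] C[of ?n] U X by (simp add: assoc_mult_mat[of _ q q _ p _ q])
  qed
  have vu: "conv q q v u = delta ?Q"
  proof
    fix m show "conv q q v u m = delta ?Q m"
      unfolding C_def[symmetric] by (cases m) (use dims in \<open>auto simp: C0 C_Suc delta_def\<close>)
  qed
  show ?thesis
    unfolding v_def[symmetric]
    by unfold_locales
      (use u v mp uv vu u_range u_kernel v_range v_kernel in \<open>simp_all add: v0 U_def X_def\<close>)
qed

section \<open>The plus transform as a product of power series\<close>

lemma plus_transform_carrier:
  assumes "\<And>j. x j \<in> carrier_mat r c"
  shows "plus_transform \<alpha> x j \<in> carrier_mat r c"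
  using assms by (auto simp: plus_transform_def)

text \<open>The coefficients of \<open>1 - \<alpha> z\<close>.\<close>

definition lin_seq :: "nat \<Rightarrow> complex \<Rightarrow> nat \<Rightarrow> complex mat" where
  "lin_seq r \<alpha> j = (if j = 0 then 1\<^sub>m r else if j = 1 then (- \<alpha>) \<cdot>\<^sub>m 1\<^sub>m r else 0\<^sub>m r r)"

text \<open>The coefficients of the inverse series \<open>1 / (1 - \<alpha> z)\<close>.\<close>

definition geom_seq :: "nat \<Rightarrow> complex \<Rightarrow> nat \<Rightarrow> complex mat" where
  "geom_seq r \<alpha> j = \<alpha> ^ j \<cdot>\<^sub>m 1\<^sub>m r"

lemma lin_seq_carrier [simp]: "lin_seq r \<alpha> j \<in> carrier_mat r r"
  and geom_seq_carrier [simp]: "geom_seq r \<alpha> j \<in> carrier_mat r r"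
  by (auto simp: lin_seq_def geom_seq_def)

lemma conv_lin_seq_left:
  assumes x: "\<And>j. x j \<in> carrier_mat r c"
  shows "conv r c (lin_seq r \<alpha>) x = plus_transform \<alpha> x"
proof
  fix m show "conv r c (lin_seq r \<alpha>) x m = plus_transform \<alpha> x m"
  proof (rule eq_matI)
    note px = plus_transform_carrier[of x r c \<alpha> m, OF x]
    fix a b assume "a < dim_row (plus_transform \<alpha> x m)" "b < dim_col (plus_transform \<alpha> x m)"
    then have ab: "a < r" "b < c" using px by auto
    have "conv r c (lin_seq r \<alpha>) x m $$ (a, b)
        = (\<Sum>l\<le>m. (if l = 0 then x m $$ (a, b) else 0) + (if l = 1 then - \<alpha> * x (m - 1) $$ (a, b) else 0))"
      unfolding conv_def index_mat_sum[OF ab] using ab x[of m] x[of "m - 1"]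
      by (intro sum.cong) (auto simp: lin_seq_def left_mult_zero_mat[OF x] left_mult_one_mat[OF x]
          mult_smult_assoc_mat[OF one_carrier_mat x] simp del: index_mult_mat(1))
    then show "conv r c (lin_seq r \<alpha>) x m $$ (a, b) = plus_transform \<alpha> x m $$ (a, b)"
      using ab x[of m] x[of "m - 1"] by (cases m) (auto simp: plus_transform_def sum.distrib)
  qed (use plus_transform_carrier[of x r c \<alpha> m, OF x] in \<open>auto simp: conv_def\<close>)
qed

lemma conv_lin_seq_right:
  assumes x: "\<And>j. x j \<in> carrier_mat r c"
  shows "conv r c x (lin_seq c \<alpha>) = plus_transform \<alpha> x"
proof
  fix m show "conv r c x (lin_seq c \<alpha>) m = plus_transform \<alpha> x m"
  proof (rule eq_matI)
    note px = plus_transform_carrier[of x r c \<alpha> m, OF x]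
    fix a b assume "a < dim_row (plus_transform \<alpha> x m)" "b < dim_col (plus_transform \<alpha> x m)"
    then have ab: "a < r" "b < c" using px by auto
    have "conv r c x (lin_seq c \<alpha>) m $$ (a, b)
        = (\<Sum>l\<le>m. (if l = 0 then x m $$ (a, b) else 0) + (if l = 1 then - \<alpha> * x (m - 1) $$ (a, b) else 0))"
      unfolding conv_flip index_mat_sum[OF ab] using ab x[of m] x[of "m - 1"]
      by (intro sum.cong) (auto simp: lin_seq_def right_mult_zero_mat[OF x] right_mult_one_mat[OF x]
          mult_smult_distrib[OF x one_carrier_mat] simp del: index_mult_mat(1))
    then show "conv r c x (lin_seq c \<alpha>) m $$ (a, b) = plus_transform \<alpha> x m $$ (a, b)"
      using ab x[of m] x[of "m - 1"] by (cases m) (auto simp: plus_transform_def sum.distrib)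
  qed (use plus_transform_carrier[of x r c \<alpha> m, OF x] in \<open>auto simp: conv_def\<close>)
qed

lemma plus_transform_geom_seq: "plus_transform \<alpha> (geom_seq r \<alpha>) = delta (1\<^sub>m r)"
proof
  fix j show "plus_transform \<alpha> (geom_seq r \<alpha>) j = delta (1\<^sub>m r) j"
    by (cases j; intro eq_matI) (auto simp: plus_transform_def geom_seq_def delta_def)
qed

lemma conv_geom_plus:
  assumes x: "\<And>j. x j \<in> carrier_mat r c"
  shows "conv r c (geom_seq r \<alpha>) (plus_transform \<alpha> x) = x"
    and "conv r c (plus_transform \<alpha> x) (geom_seq c \<alpha>) = x"
proof -
  have "conv r c (geom_seq r \<alpha>) (plus_transform \<alpha> x) = conv r c (conv r r (geom_seq r \<alpha>) (lin_seq r \<alpha>)) x"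
    by (simp only: conv_lin_seq_left[OF x, symmetric] conv_assoc[OF geom_seq_carrier lin_seq_carrier x])
  also have "conv r r (geom_seq r \<alpha>) (lin_seq r \<alpha>) = delta (1\<^sub>m r)"
    by (simp add: conv_lin_seq_right plus_transform_geom_seq)
  finally show "conv r c (geom_seq r \<alpha>) (plus_transform \<alpha> x) = x"
    using x by (simp add: conv_delta_left[OF one_carrier_mat x] left_mult_one_mat[OF x])
  have "conv r c (plus_transform \<alpha> x) (geom_seq c \<alpha>) = conv r c x (conv c c (lin_seq c \<alpha>) (geom_seq c \<alpha>))"
    by (simp only: conv_lin_seq_right[OF x, symmetric] conv_assoc[OF x lin_seq_carrier geom_seq_carrier])
  also have "conv c c (lin_seq c \<alpha>) (geom_seq c \<alpha>) = delta (1\<^sub>m c)"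
    by (simp add: conv_lin_seq_left plus_transform_geom_seq)
  finally show "conv r c (plus_transform \<alpha> x) (geom_seq c \<alpha>) = x"
    using x by (simp add: conv_delta_right[OF one_carrier_mat x] right_mult_one_mat[OF x])
qed

lemma S_lower_delta_one: "S_lower r r n (delta (1\<^sub>m r)) = 1\<^sub>m ((n + 1) * r)"
  by (simp only: S_lower_delta[OF one_carrier_mat] block_mat_one)

text \<open>The inverted matrix is the Toeplitz matrix of \<open>1 - z X\<close> as a polynomial in the series variable
\<open>X\<close>, so its inverse is the Toeplitz matrix of the geometric series.\<close>

lemma R_mat_eq: "R_mat r n z = S_lower r r n (geom_seq r z)"
proof -
  let ?N = "(n + 1) * r"
  let ?L = "1\<^sub>m ?N - z \<cdot>\<^sub>m T_mat r n" and ?G = "S_lower r r n (geom_seq r z)"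
  have L: "?L = S_lower r r n (lin_seq r z)"
  proof -
    have "(if j = k then 1\<^sub>m r else 0\<^sub>m r r) - z \<cdot>\<^sub>m (if j = k + 1 then 1\<^sub>m r else 0\<^sub>m r r)
        = (if k \<le> j then lin_seq r z (j - k) else 0\<^sub>m r r)" for j k :: nat
    proof -
      consider "j = k" | "j = k + 1" | "j < k" | "k + 1 < j" by linarith
      then show ?thesis by cases (auto intro!: eq_matI simp: lin_seq_def)
    qed
    then show ?thesis
      unfolding T_mat_def block_mat_one[symmetric] S_lower_def
      by (subst block_mat_smult; (subst block_mat_minus)?) (auto intro!: block_mat_eqI)
  qed
  have Lc: "?L \<in> carrier_mat ?N ?N" and Gc: "?G \<in> carrier_mat ?N ?N"
    unfolding L by (auto intro: carrier_matI)
  have LG: "?L * ?G = 1\<^sub>m ?N" and GL: "?G * ?L = 1\<^sub>m ?N"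
    unfolding L by (simp_all only: S_lower_mult lin_seq_carrier geom_seq_carrier
        conv_lin_seq_left conv_lin_seq_right plus_transform_geom_seq S_lower_delta_one)
  have "?L \<in> Units (ring_mat TYPE(complex) ?N ())"
    unfolding Units_def ring_mat_def using Lc Gc LG GL by auto
  then obtain B where B: "mat_inverse ?L = Some B"
    using mat_inverse(1)[OF Lc] by fastforce
  have LB: "?L * B = 1\<^sub>m ?N" and Bc: "B \<in> carrier_mat ?N ?N" using mat_inverse(2)[OF Lc B] by auto
  have "B = (?G * ?L) * B" unfolding GL using Bc by simp
  also have "\<dots> = ?G * (?L * B)" by (rule assoc_mult_mat[OF Gc Lc Bc])
  also have "\<dots> = ?G" unfolding LB using Gc by simp
  finally show ?thesis unfolding R_mat_def B by simp
qed

lemma adjoint_R_mat: "mat_adjoint (R_mat r n (cnj z)) = S_upper r r n (geom_seq r z)"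
  unfolding R_mat_eq S_lower_def S_upper_def
  by (subst block_mat_adjoint) (auto intro!: block_mat_eqI eq_matI simp: mat_adjoint_alt geom_seq_def)

section \<open>Determinants of block Toeplitz matrices\<close>

lemma det_S_lower:
  assumes x: "\<And>j. x j \<in> carrier_mat r r"
  shows "det (S_lower r r n x) = det (x 0) ^ (n + 1)"
proof (induction n)
  case 0
  have "S_lower r r 0 x = block_mat r r 1 1 (\<lambda>j k. x 0)"
    unfolding S_lower_def add_0 by (rule block_mat_eqI) simp
  then have "S_lower r r 0 x = x 0" by (simp only: block_mat_single[OF x])
  then show ?case by simp
next
  case (Suc n)
  let ?A = "S_lower r r n x" and ?N = "(n + 1) * r"
  let ?C = "block_mat r r 1 (n + 1) (\<lambda>j k. x (n + 1 - k))"
  have "S_lower r r (Suc n) x = four_block_mat ?A (0\<^sub>m ?N r) ?C (x 0)"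
  proof (rule eq_matI_blocks[of _ "Suc n + 1" r "Suc n + 1" r])
    fix j k a b assume jk: "j < Suc n + 1" "k < Suc n + 1" and ab: "a < r" "b < r"
    have lt: "i * r + d < ?N" if "i < n + 1" "d < r" for i d
      using that by (rule block_index_less)
    have "four_block_mat ?A (0\<^sub>m ?N r) ?C (x 0) $$ (j * r + a, k * r + b)
        = (if k \<le> j then x (j - k) else 0\<^sub>m r r) $$ (a, b)"
    proof (cases "j < n + 1"; cases "k < n + 1")
      assume "j < n + 1" "k < n + 1"
      then have "?A $$ (j * r + a, k * r + b) = (if k \<le> j then x (j - k) else 0\<^sub>m r r) $$ (a, b)"
        unfolding S_lower_def using ab by (rule index_block_mat)
      then show ?thesis using \<open>j < n + 1\<close> \<open>k < n + 1\<close> ab lt[of j a] lt[of k b] x[of 0] by simp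
    next
      assume *: "j < n + 1" "\<not> k < n + 1"
      then have "k = n + 1" using jk by simp
      then show ?thesis using * ab lt[of j a] x[of 0] by simp
    next
      assume *: "\<not> j < n + 1" "k < n + 1"
      then have "j = n + 1" using jk by simp
      then show ?thesis using * ab lt[of k b] x[of 0] index_block_mat[of 0 1 k "n + 1" a r b r "\<lambda>j k. x (n + 1 - k)"]
        by simp
    next
      assume "\<not> j < n + 1" "\<not> k < n + 1"
      then have "j = n + 1" "k = n + 1" using jk by simp_all
      then show ?thesis using ab x[of 0] by simp
    qed
    then show "S_lower r r (Suc n) x $$ (j * r + a, k * r + b)
        = four_block_mat ?A (0\<^sub>m ?N r) ?C (x 0) $$ (j * r + a, k * r + b)"
      unfolding S_lower_def by (simp only: index_block_mat[OF jk ab])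
  qed (use x[of 0] in \<open>auto intro!: carrier_matI\<close>)
  then have "det (S_lower r r (Suc n) x) = det ?A * det (x 0)"
    using x[of 0] by (simp only:, intro det_four_block_mat_upper_right_zero[of _ ?N _ r])
      (auto intro!: carrier_matI)
  then show ?case using Suc by simp
qed

lemma det_S_upper:
  assumes x: "\<And>j. x j \<in> carrier_mat r r"
  shows "det (S_upper r r n x) = det (x 0) ^ (n + 1)"
proof -
  have "transpose_mat (S_lower r r n (\<lambda>j. transpose_mat (x j))) = S_upper r r n x"
  proof (rule eq_matI_blocks[of _ "n + 1" r "n + 1" r])
    fix j k a b assume jk: "j < n + 1" "k < n + 1" and ab: "a < r" "b < r"
    show "transpose_mat (S_lower r r n (\<lambda>j. transpose_mat (x j))) $$ (j * r + a, k * r + b)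
        = S_upper r r n x $$ (j * r + a, k * r + b)"
    proof -
      have "transpose_mat (S_lower r r n (\<lambda>j. transpose_mat (x j))) $$ (j * r + a, k * r + b)
          = S_lower r r n (\<lambda>j. transpose_mat (x j)) $$ (k * r + b, j * r + a)"
        using block_index_less[OF jk(1) ab(1)] block_index_less[OF jk(2) ab(2)] by simp
      also have "\<dots> = (if j \<le> k then transpose_mat (x (k - j)) else 0\<^sub>m r r) $$ (b, a)"
        unfolding S_lower_def by (rule index_block_mat[OF jk(2,1) ab(2,1)])
      also have "\<dots> = (if j \<le> k then x (k - j) else 0\<^sub>m r r) $$ (a, b)"
        using ab x[of "k - j"] by simp
      also have "\<dots> = S_upper r r n x $$ (j * r + a, k * r + b)"
        unfolding S_upper_def by (rule index_block_mat[OF jk ab, symmetric])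
      finally show ?thesis .
    qed
  qed (auto intro: carrier_matI)
  then have "det (S_upper r r n x) = det (S_lower r r n (\<lambda>j. transpose_mat (x j)))"
    using det_transpose[of "S_lower r r n (\<lambda>j. transpose_mat (x j))" "(n + 1) * r"]
    by (simp add: carrier_matI)
  also have "\<dots> = det (x 0) ^ (n + 1)"
    using x det_transpose[OF x[of 0]] by (simp add: det_S_lower)
  finally show ?thesis .
qed

section \<open>Domination by the first term\<close>

text \<open>The columns of \<open>1 - A\<^sup>\<dagger> A\<close> lie in the kernel of \<open>A\<close>.\<close>

lemma mult_mp_projection_of_kernel:
  assumes A: "A \<in> carrier_mat p q" and B: "B \<in> carrier_mat p q"
    and ker: "mat_kernel A \<subseteq> mat_kernel B"
  shows "B * (mp_inverse A * A) = B"
proof -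
  let ?Q = "mp_inverse A * A"
  note mp = is_mp_inverse_mp_inverse[of A, unfolded is_mp_inverse_def]
  have X: "mp_inverse A \<in> carrier_mat q p" using mp A by auto
  have Q: "?Q \<in> carrier_mat q q" using X A by auto
  define Z where "Z = 1\<^sub>m q - ?Q"
  have Z: "Z \<in> carrier_mat q q" unfolding Z_def using Q by (rule minus_carrier_mat)
  have "A * ?Q = A" using mp A X by (metis assoc_mult_mat)
  then have AZ: "A * Z = 0\<^sub>m p q"
    unfolding Z_def using A Q by (subst mult_minus_distrib_mat[OF A one_carrier_mat Q]) auto
  have "B * Z = 0\<^sub>m p q"
  proof (rule mat_col_eqI)
    fix i assume "i < dim_col (0\<^sub>m p q :: complex mat)"
    then have i: "i < q" by simp
    have "A *\<^sub>v col Z i = col (A * Z) i" by (rule col_mult2[OF A Z i, symmetric])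
    then have "col Z i \<in> mat_kernel A" using A Z i unfolding AZ by (auto simp: mat_kernel_def)
    then have "col Z i \<in> mat_kernel B" using ker by auto
    then have "B *\<^sub>v col Z i = 0\<^sub>v p" using B by (auto simp: mat_kernel_def)
    then show "col (B * Z) i = col (0\<^sub>m p q) i" unfolding col_mult2[OF B Z i] using i by simp
  qed (use B Z in auto)
  moreover have "B * Z = B - B * ?Q"
    unfolding Z_def using B by (subst mult_minus_distrib_mat[OF B one_carrier_mat Q]) simp
  ultimately have "B = B * ?Q" by (intro mat_minus_eq_0D[of B _ p q]) (use B Q in auto)
  then show ?thesis by simp
qed

text \<open>The matrix \<open>A A\<^sup>\<dagger>\<close> fixes every vector of the form \<open>A x\<close>.\<close>

lemma mp_projection_mult_of_col_space:
  assumes A: "A \<in> carrier_mat p q" and B: "B \<in> carrier_mat p q"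
    and sub: "col_space_of B \<subseteq> col_space_of A"
  shows "A * mp_inverse A * B = B"
proof (rule mat_col_eqI)
  note mp = is_mp_inverse_mp_inverse[of A, unfolded is_mp_inverse_def]
  have X: "mp_inverse A \<in> carrier_mat q p" using mp A by auto
  have P: "A * mp_inverse A \<in> carrier_mat p p" using X A by auto
  fix i assume i: "i < dim_col B"
  have iq: "i < q" using i B by simp
  have "col B i = B *\<^sub>v unit_vec q i" 
    using col_mult2[OF B one_carrier_mat iq] right_mult_one_mat[OF B] iq by simp
  then have "col B i \<in> col_space_of B"
    unfolding col_space_of_def carrier_matD(1)[OF B] vec_space.col_space_eq[OF B] using B iq
    by (auto intro!: bexI[of _ "unit_vec q i"])
  then have "col B i \<in> vec_space.col_space p A" using sub A by (auto simp: col_space_of_def)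
  then obtain x where x: "x \<in> carrier_vec q" "col B i = A *\<^sub>v x"
    unfolding vec_space.col_space_eq[OF A] using A by auto
  have "col (A * mp_inverse A * B) i = (A * mp_inverse A) *\<^sub>v (A *\<^sub>v x)"
    by (simp only: col_mult2[OF P B iq] x(2))
  also have "\<dots> = (A * mp_inverse A * A) *\<^sub>v x"
    by (rule assoc_mult_mat_vec[OF P A x(1), symmetric])
  also have "\<dots> = col B i" using mp x by simp
  finally show "col (A * mp_inverse A * B) i = col B i" .
qed (use A B in auto)

lemma plus_transform_0 [simp]: "plus_transform \<alpha> x 0 = x 0"
  by (simp add: plus_transform_def)

lemma plus_transform_mult_left:
  assumes A: "A \<in> carrier_mat m r" and x: "\<And>i. i \<le> j \<Longrightarrow> x i \<in> carrier_mat r c"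
  shows "A * plus_transform \<alpha> x j = plus_transform \<alpha> (\<lambda>i. A * x i) j"
proof (cases j)
  case (Suc i)
  then show ?thesis
    using A x[of i] x[of j]
    by (simp add: plus_transform_def mult_add_distrib_mat[of A m r _ c] mult_smult_distrib[of A m r _ c])
qed simp

lemma plus_transform_mult_right:
  assumes A: "A \<in> carrier_mat c m" and x: "\<And>i. i \<le> j \<Longrightarrow> x i \<in> carrier_mat r c"
  shows "plus_transform \<alpha> x j * A = plus_transform \<alpha> (\<lambda>i. x i * A) j"
proof (cases j)
  case (Suc i)
  then show ?thesis
    using A x[of i] x[of j]
    by (simp add: plus_transform_def add_mult_distrib_mat[of _ r c _ A m] mult_smult_assoc_mat[of _ r c A m])
qed simp

lemma plus_transform_cong:
  "(\<And>i. i \<le> j \<Longrightarrow> x i = y i) \<Longrightarrow> plus_transform \<alpha> x j = plus_transform \<alpha> y j"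
  by (auto simp: plus_transform_def)

text \<open>If \<open>v\<close> is reciprocal to \<open>(1 - \<alpha> z) t\<close>, then \<open>(1 - \<alpha> z) v\<close> is a right inverse of \<open>t\<close>. Multiplying
by the left inverse \<open>w\<close> of \<open>t\<close> identifies the two.\<close>

lemma reciprocal_plus_transform:
  assumes T: "reciprocal_pair p q t w" and U: "reciprocal_pair p q (plus_transform \<alpha> t) v"
  shows "w = plus_transform \<alpha> v"
proof -
  interpret T: reciprocal_pair p q t w by (rule T)
  interpret U: reciprocal_pair p q "plus_transform \<alpha> t" v by (rule U)
  note pv = plus_transform_carrier[of v q p \<alpha>, OF U.v]
  have v0: "v 0 = w 0" using T.mp_inverse_u0 U.mp_inverse_u0 by simp
  have "conv p p t (plus_transform \<alpha> v) = conv p p (conv p q t (lin_seq q \<alpha>)) v"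
    by (simp only: conv_lin_seq_left[OF U.v, symmetric] conv_assoc[OF T.u lin_seq_carrier U.v])
  also have "\<dots> = delta (t 0 * w 0)"
    by (simp add: conv_lin_seq_right[OF T.u] U.uv v0)
  finally have "conv q p w (conv p p t (plus_transform \<alpha> v)) = w"
    by (simp add: conv_delta_right[OF T.P T.v] T.v_kernel)
  then have "w = conv q p (conv q q w t) (plus_transform \<alpha> v)"
    by (simp only: conv_assoc[OF T.v T.u pv])
  also have "\<dots> = (\<lambda>j. w 0 * t 0 * plus_transform \<alpha> v j)"
    by (simp add: T.vu conv_delta_left[OF T.Q pv])
  also have "\<dots> = plus_transform \<alpha> v"
  proof
    fix j
    have "w 0 * t 0 * plus_transform \<alpha> v j = plus_transform \<alpha> (\<lambda>i. w 0 * t 0 * v i) j"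
      by (rule plus_transform_mult_left[OF T.Q U.v])
    also have "(\<lambda>i. w 0 * t 0 * v i) = v" using U.v_range by (simp add: v0)
    finally show "w 0 * t 0 * plus_transform \<alpha> v j = plus_transform \<alpha> v j" .
  qed
  finally show ?thesis .
qed

lemma S_lower_plus_transform:
  assumes "\<And>j. x j \<in> carrier_mat r c"
  shows "R_mat r n \<alpha> * S_lower r c n (plus_transform \<alpha> x) = S_lower r c n x"
  unfolding R_mat_eq
  by (simp add: S_lower_mult[OF geom_seq_carrier plus_transform_carrier[of x, OF assms]] conv_geom_plus(1)[OF assms])

lemma S_upper_plus_transform:
  assumes "\<And>j. x j \<in> carrier_mat r c"
  shows "S_upper r c n (plus_transform \<alpha> x) * mat_adjoint (R_mat c n (cnj \<alpha>)) = S_upper r c n x"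
  unfolding adjoint_R_mat
  by (simp add: S_upper_mult[OF plus_transform_carrier[of x, OF assms] geom_seq_carrier] conv_geom_plus(2)[OF assms])

text \<open>In the recursion \<open>u\<^sub>j\<close> only occurs between a factor \<open>u\<^sub>0\<^sup>\<dagger>\<close> on the left and a reciprocal term
on the right, and these absorb the projections \<open>P = u\<^sub>0 u\<^sub>0\<^sup>\<dagger>\<close> and \<open>Q = u\<^sub>0\<^sup>\<dagger> u\<^sub>0\<close>. Replacing \<open>u\<^sub>j\<close> by
\<open>P u\<^sub>j Q\<close> therefore does not change the reciprocal sequence.\<close>

lemma reciprocal_seq_compress:
  assumes pair: "reciprocal_pair p q u' (reciprocal_seq u')" and u0: "u 0 = u' 0"
    and u: "\<And>j. j \<le> m \<Longrightarrow> u j \<in> carrier_mat p q"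
    and u': "\<And>j. j \<le> m \<Longrightarrow> u' j = u 0 * mp_inverse (u 0) * u j * (mp_inverse (u 0) * u 0)"
    and j: "j \<le> m"
  shows "reciprocal_seq u j = reciprocal_seq u' j"
  using j
proof (induction j rule: less_induct)
  case (less j)
  interpret V: reciprocal_pair p q u' "reciprocal_seq u'" by (rule pair)
  let ?v = "reciprocal_seq u'"
  define U X where "U = u 0" and "X = mp_inverse (u 0)"
  have U: "U \<in> carrier_mat p q" using u0 reciprocal_pair.u[OF pair, of 0] by (simp add: U_def)
  have mp: "is_mp_inverse U X" unfolding U_def X_def by (rule is_mp_inverse_mp_inverse)
  have X: "X \<in> carrier_mat q p" using mp U by (auto simp: is_mp_inverse_def)
  have XUX: "X * (U * X) = X"
    using mp assoc_mult_mat[OF X U X] by (simp add: is_mp_inverse_def)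
  have v0: "?v 0 = X" by (simp add: X_def u0)
  have Qv: "X * U * ?v l = ?v l" for l using V.v_range[of l] unfolding v0 U_def u0 .
  show ?case
  proof (cases j)
    case 0
    then show ?thesis by (simp add: u0)
  next
    case (Suc i)
    have key: "X * (u (Suc i - l) * reciprocal_seq u l) = X * (u' (Suc i - l) * ?v l)"
      if "l < Suc i" for l
    proof -
      have ul: "u (Suc i - l) \<in> carrier_mat p q" using less.prems Suc by (intro u) simp
      note vl = reciprocal_pair.v[OF pair, of l]
      have "X * (u' (Suc i - l) * ?v l) = X * (U * X) * (u (Suc i - l) * (X * U * ?v l))"
      proof -
        have dims: "dim_row U = p" "dim_col U = q" "dim_row X = q" "dim_col X = p"
            "dim_row (u (Suc i - l)) = p" "dim_col (u (Suc i - l)) = q" "dim_row (?v l) = q"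
          using U X ul vl by auto
        have "u' (Suc i - l) = U * X * u (Suc i - l) * (X * U)"
          unfolding U_def X_def using less.prems Suc by (intro u') simp
        then show ?thesis using dims by (simp add: mult_mat_assoc)
      qed
      also have "\<dots> = X * (u (Suc i - l) * ?v l)" unfolding XUX Qv ..
      finally have "X * (u' (Suc i - l) * ?v l) = X * (u (Suc i - l) * ?v l)" .
      moreover have "reciprocal_seq u l = ?v l" using less that Suc by simp
      ultimately show ?thesis by (simp only:)
    qed
    have "X * mat_sum p p (\<lambda>l. u (Suc i - l) * reciprocal_seq u l) {..<Suc i}
        = mat_sum q p (\<lambda>l. X * (u (Suc i - l) * reciprocal_seq u l)) {..<Suc i}"
    proof (rule mult_mat_sum[OF X])
      fix l assume "l \<in> {..<Suc i}"
      then have "reciprocal_seq u l = ?v l" "u (Suc i - l) \<in> carrier_mat p q"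
        using less Suc by (auto intro: u)
      then show "u (Suc i - l) * reciprocal_seq u l \<in> carrier_mat p p"
        using reciprocal_pair.v[OF pair, of l] by simp
    qed
    also have "\<dots> = mat_sum q p (\<lambda>l. X * (u' (Suc i - l) * ?v l)) {..<Suc i}"
      by (rule mat_sum_cong) (auto simp: key)
    also have "\<dots> = X * mat_sum p p (\<lambda>l. u' (Suc i - l) * ?v l) {..<Suc i}"
      by (rule mult_mat_sum[OF X, symmetric])
        (rule mult_carrier_mat[OF reciprocal_pair.u[OF pair] reciprocal_pair.v[OF pair]])
    finally show ?thesis
      using Suc U reciprocal_pair.u[OF pair, of 0] by (simp add: X_def U_def u0[symmetric])
  qed
qed

lemma G_mat_cong:
  "(\<And>j. j \<le> 2 * n + 2 \<Longrightarrow> x j = y j) \<Longrightarrow> G_mat r c n x = G_mat r c n y"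
  unfolding G_mat_def block_hankel_def by (rule block_mat_eqI) auto

lemma S_lower_cong: "(\<And>j. j \<le> n \<Longrightarrow> x j = y j) \<Longrightarrow> S_lower r c n x = S_lower r c n y"
  unfolding S_lower_def by (rule block_mat_eqI) auto

lemma S_upper_cong: "(\<And>j. j \<le> n \<Longrightarrow> x j = y j) \<Longrightarrow> S_upper r c n x = S_upper r c n y"
  unfolding S_upper_def by (rule block_mat_eqI) auto

lemma block_hankel_cong:
  "(\<And>j. j \<le> 2 * n \<Longrightarrow> x j = y j) \<Longrightarrow> block_hankel r c n x = block_hankel r c n y"
  unfolding block_hankel_def by (rule block_mat_eqI) auto

lemma block_column_cong:
  "(\<And>j. j \<le> n \<Longrightarrow> x j = y j) \<Longrightarrow> block_column r c n x = block_column r c n y"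
  unfolding block_column_def by (rule block_mat_eqI) auto

lemma block_row_cong:
  "(\<And>j. j \<le> n \<Longrightarrow> x j = y j) \<Longrightarrow> block_row r c n x = block_row r c n y"
  unfolding block_row_def by (rule block_mat_eqI) auto

lemma Lambda_Suc_cong:
  assumes "\<And>j. j \<le> 2 * n + 2 \<Longrightarrow> x j = y j"
  shows "Lambda_Suc r c n x = Lambda_Suc r c n y"
  unfolding Lambda_Suc_def
  using assms G_mat_cong[of n x y] block_column_cong[of n "\<lambda>j. x (j + 1)" "\<lambda>j. y (j + 1)"]
    block_row_cong[of n "\<lambda>j. x (j + 1)" "\<lambda>j. y (j + 1)"] by auto

lemma shift_seq_eq: "shift_seq \<alpha> s = (\<lambda>j. plus_transform \<alpha> s (j + 1))"
  by (auto simp: shift_seq_def plus_transform_def)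

text \<open>The shifted sequence is the plus transform with its first term dropped, so that the matrix built
from \<open>K\<close>, \<open>y\<close> and \<open>z\<close> literally is \<open>\<Lambda>\<close> of the plus transform.\<close>

lemma Lambda_plus_transform:
  "K_shift \<alpha> p q n s - y_shift \<alpha> p q n s * mp_inverse (s 0) * z_shift \<alpha> p q n s
    = Lambda_Suc p q n (plus_transform \<alpha> s)"
  by (simp add: K_shift_def y_shift_def z_shift_def Lambda_Suc_def G_mat_def shift_seq_eq)

section \<open>Compression and rank\<close>

context reciprocal_pair
begin

lemma S_lower_mult_P: "S_lower q p n v * S_lower p p n (delta (u 0 * v 0)) = S_lower q p n v"
  by (simp add: S_lower_mult[OF v delta_carrier[OF P]] conv_delta_right[OF P v] v_kernel)

lemma Q_mult_S_upper: "S_upper q q n (delta (v 0 * u 0)) * S_upper q p n v = S_upper q p n v"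
  by (simp add: S_upper_mult[OF delta_carrier[OF Q] v] conv_delta_left[OF Q v] v_range)

text \<open>Between Toeplitz matrices of \<open>v\<close> only the compressed blocks \<open>P f\<^sub>j\<^sub>k Q\<close> matter. This is what makes
the last, unconstrained matrix of the sequence harmless.\<close>

lemma sandwich_compress:
  assumes f: "\<And>j k. j < n + 1 \<Longrightarrow> k < n + 1 \<Longrightarrow> f j k \<in> carrier_mat p q"
  shows "S_lower q p n v * block_mat p q (n + 1) (n + 1) f * S_upper q p n v
    = S_lower q p n v * block_mat p q (n + 1) (n + 1) (\<lambda>j k. u 0 * v 0 * f j k * (v 0 * u 0)) * S_upper q p n v"
proof -
  let ?F = "block_mat p q (n + 1) (n + 1) f"
  have "S_lower p p n (delta (u 0 * v 0)) * ?F * S_upper q q n (delta (v 0 * u 0))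
      = block_mat p q (n + 1) (n + 1) (\<lambda>j k. u 0 * v 0 * f j k) * S_upper q q n (delta (v 0 * u 0))"
    unfolding S_lower_delta[OF P] using f by (subst diag_mult_block_mat) auto
  also have "\<dots> = block_mat p q (n + 1) (n + 1) (\<lambda>j k. u 0 * v 0 * f j k * (v 0 * u 0))"
    unfolding S_upper_delta[OF Q] by (rule block_mat_mult_diag[OF Q]) (rule mult_carrier_mat[OF P f])
  finally have "block_mat p q (n + 1) (n + 1) (\<lambda>j k. u 0 * v 0 * f j k * (v 0 * u 0))
      = S_lower p p n (delta (u 0 * v 0)) * ?F * S_upper q q n (delta (v 0 * u 0))" ..
  then have "S_lower q p n v * block_mat p q (n + 1) (n + 1) (\<lambda>j k. u 0 * v 0 * f j k * (v 0 * u 0)) * S_upper q p n v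
      = (S_lower q p n v * S_lower p p n (delta (u 0 * v 0))) * ?F
        * (S_upper q q n (delta (v 0 * u 0)) * S_upper q p n v)"
    by (simp add: mult_mat_assoc)
  then show ?thesis by (simp only: S_lower_mult_P Q_mult_S_upper)
qed

lemma P_mult_Lambda: "S_lower p p n (delta (u 0 * v 0)) * Lambda_Suc p q n u = Lambda_Suc p q n u"
proof -
  let ?D = "S_lower p p n (delta (u 0 * v 0))" and ?N = "n + 1"
  let ?G = "G_mat p q n u" and ?c = "block_column p q n (\<lambda>j. u (j + 1))" and ?r = "block_row p q n (\<lambda>j. u (j + 1))"
  have G: "?D * ?G = ?G"
    unfolding S_lower_delta[OF P] G_mat_def block_hankel_def using u
    by (subst diag_mult_block_mat) (auto simp: u_range)
  have c: "?D * ?c = ?c"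
    unfolding S_lower_delta[OF P] block_column_def using u
    by (subst diag_mult_block_mat) (auto simp: u_range simp del: One_nat_def)
  have v0: "dim_row (v 0) = q" "dim_col (v 0) = p" using v[of 0] by auto
  have "?D * (?G - ?c * v 0 * ?r) = ?D * ?G - ?D * (?c * v 0 * ?r)"
    by (rule mult_minus_distrib_mat[of _ "?N * p" "?N * p" _ "?N * q"]) (auto intro!: carrier_matI)
  also have "?D * (?c * v 0 * ?r) = (?D * ?c) * v 0 * ?r" by (simp add: mult_mat_assoc v0)
  finally show ?thesis unfolding G c by (simp add: Lambda_Suc_def mp_inverse_u0)
qed

text \<open>The converse of the formula for \<open>G(v)\<close>: from \<open>S(v) \<Lambda>(u) = - G(v) \<S>(u)\<close>, multiply by \<open>S(u)\<close> and
use that \<open>S(u) S(v)\<close> acts as the unit on \<open>\<Lambda>(u)\<close>. Both formulas together give equal ranks.\<close>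

lemma Lambda_eq_G: "Lambda_Suc p q n u = - S_lower p q n u * G_mat q p n v * S_upper p q n u"
proof -
  have "Lambda_Suc p q n u = S_lower p q n u * (S_lower q p n v * Lambda_Suc p q n u)"
  proof -
    have "S_lower p q n u * (S_lower q p n v * Lambda_Suc p q n u)
        = S_lower p q n u * S_lower q p n v * Lambda_Suc p q n u"
      by (simp add: mult_mat_assoc)
    also have "S_lower p q n u * S_lower q p n v = S_lower p p n (delta (u 0 * v 0))"
      by (simp add: S_lower_mult[OF u v] uv)
    finally show ?thesis by (simp only: P_mult_Lambda)
  qed
  then show ?thesis unfolding S_lower_Lambda by (simp add: mult_mat_assoc)
qed

lemma rank_G_eq: "rank_of (G_mat q p n v) = rank_of (Lambda_Suc p q n u)"
proof (rule antisym)
  let ?N = "n + 1"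
  have "rank_of (- S_lower q p n v * Lambda_Suc p q n u * S_upper q p n v) \<le> rank_of (Lambda_Suc p q n u)"
    by (rule rank_of_mult_le[of _ "?N * q" "?N * p" _ "?N * q" _ "?N * p"]) (auto intro: carrier_matI)
  also have "- S_lower q p n v * Lambda_Suc p q n u * S_upper q p n v = G_mat q p n v"
    by (simp add: G_eq_Lambda)
  finally show "rank_of (G_mat q p n v) \<le> rank_of (Lambda_Suc p q n u)" .
  have "rank_of (- S_lower p q n u * G_mat q p n v * S_upper p q n u) \<le> rank_of (G_mat q p n v)"
    by (rule rank_of_mult_le[of _ "?N * p" "?N * q" _ "?N * p" _ "?N * q"]) (auto intro: carrier_matI)
  then show "rank_of (Lambda_Suc p q n u) \<le> rank_of (G_mat q p n v)" by (simp only: Lambda_eq_G)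
qed

end

section \<open>The Hankel matrices of the transformed sequence\<close>

theorem theorem5p8:
  fixes p q n :: nat and \<alpha> :: complex and s :: "nat \<Rightarrow> complex mat"
  assumes "p \<ge> 1" and "q \<ge> 1"
    and "s \<in> nearly_first_term_dominant p q (2 * n + 2)"
  shows
    "G_mat q p n (sharp_seq \<alpha> s) =
       - (S_lower q p n (sharp_seq \<alpha> s) * Lambda_Suc p q n (plus_transform \<alpha> s)
          * S_upper q p n (sharp_seq \<alpha> s))
     \<and>
     G_mat q p n (sharp_seq \<alpha> s) =
       - (R_mat q n \<alpha> * mp_inverse (S_lower p q n s)
          * (K_shift \<alpha> p q n s - y_shift \<alpha> p q n s * mp_inverse (s 0) * z_shift \<alpha> p q n s)
          * mp_inverse (S_upper p q n s) * mat_adjoint (R_mat p n (cnj \<alpha>)))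
     \<and>
     G_mat q p n (sharp_seq \<alpha> s) =
       - (mat_adjoint (nabla_mat q (n + 1)) * mp_inverse (S_lower p q (n + 1) s)
          * block_hankel p q (n + 1) s
          * mp_inverse (S_upper p q (n + 1) s) * nabla_mat p (n + 1))
       - \<alpha> \<cdot>\<^sub>m (R_mat q n \<alpha> * mp_inverse (S_lower p q n s) * H_shift \<alpha> p q n s
               * mp_inverse (S_upper p q n s) * mat_adjoint (R_mat p n (cnj \<alpha>)))
     \<and>
     G_mat p q n (plus_transform \<alpha> s) =
       Xi_mat p q n (2 * n + 2) s
       - S_lower p q n (plus_transform \<alpha> s) * Lambda_Suc q p n (sharp_seq \<alpha> s)
         * S_upper p q n (plus_transform \<alpha> s)
     \<and>
     rank_of (G_mat q p n (sharp_seq \<alpha> s)) =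
       rank_of (Lambda_Suc p q n (plus_transform \<alpha> s) - Xi_mat p q n (2 * n + 2) s)
     \<and>
     rank_of (G_mat q p n (sharp_seq \<alpha> s)) =
       rank_of (K_shift \<alpha> p q n s
                - y_shift \<alpha> p q n s * mp_inverse (s 0) * z_shift \<alpha> p q n s
                - Xi_mat p q n (2 * n + 2) s)
     \<and>
     (p = q \<longrightarrow>
       det (G_mat q p n (sharp_seq \<alpha> s)) =
         (inverse (det (s 0))) ^ (2 * n + 2) * det (- Lambda_Suc p q n (plus_transform \<alpha> s))
       \<and>
       det (G_mat q p n (sharp_seq \<alpha> s)) =
         (inverse (det (s 0))) ^ (2 * n + 2)
         * det (- (K_shift \<alpha> p q n s
                   - y_shift \<alpha> p q n s * mp_inverse (s 0) * z_shift \<alpha> p q n s)))"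
proof -
  let ?N = "n + 1" and ?m = "2 * n + 2"
  define U where "U = s 0"
  define X where "X = mp_inverse U"
  define u where "u = plus_transform \<alpha> s"
  have sc: "s j \<in> carrier_mat p q" if "j \<le> ?m" for j
    using assms(3) that by (simp add: nearly_first_term_dominant_def)
  have U: "U \<in> carrier_mat p q" unfolding U_def by (rule sc) simp
  have mpU: "is_mp_inverse U X" unfolding X_def by (rule is_mp_inverse_mp_inverse)
  have X: "X \<in> carrier_mat q p" using mpU U by (auto simp: is_mp_inverse_def)
  have UXU: "U * X * U = U" and XUX: "X * U * X = X" using mpU by (auto simp: is_mp_inverse_def)
  have P: "U * X \<in> carrier_mat p p" and Q: "X * U \<in> carrier_mat q q" using U X by auto
  have PP: "U * X * (U * X) = U * X"
    using assoc_mult_mat[OF P U X] UXU by simp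
  have QQ: "X * U * (X * U) = X * U"
    using assoc_mult_mat[OF Q X U] XUX by simp
  have dom: "mat_kernel U \<subseteq> mat_kernel (s j)" "col_space_of (s j) \<subseteq> col_space_of U"
    if "j \<le> 2 * n + 1" for j
    using assms(3) that by (auto simp: nearly_first_term_dominant_def first_term_dominant_def U_def)
  have Ps: "U * X * s j = s j" and sQ: "s j * (X * U) = s j" if "j \<le> 2 * n + 1" for j
    using mp_projection_mult_of_col_space[OF U sc dom(2)[OF that]]
      mult_mp_projection_of_kernel[OF U sc dom(1)[OF that]] that by (auto simp: X_def)

  \<comment> \<open>Only \<open>s\<^sub>2\<^sub>n\<^sub>+\<^sub>2\<close> is changed by the compression. Beyond the given indices \<open>t\<close> is \<open>0\<close>, so that
    \<open>t\<close> is dominated at every index and the power series identities hold without truncation.\<close>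
  define t where "t j = (if j \<le> ?m then U * X * s j * (X * U) else 0\<^sub>m p q)" for j
  have t_s: "t j = s j" if "j \<le> 2 * n + 1" for j
    using that by (simp add: t_def Ps sQ)
  have t0: "t 0 = U" by (simp add: t_s U_def)
  have t: "t j \<in> carrier_mat p q" for j
    using P Q sc[of j] by (auto simp: t_def)
  have Pt: "U * X * t j = t j" for j
  proof (cases "j \<le> ?m")
    case True
    have "U * X * (U * X * s j * (X * U)) = U * X * (U * X * s j) * (X * U)"
      by (rule assoc_mult_mat[OF P mult_carrier_mat[OF P sc[OF True]] Q, symmetric])
    also have "U * X * (U * X * s j) = U * X * s j"
      using assoc_mult_mat[OF P P sc[OF True]] PP by simp
    finally show ?thesis using True by (simp add: t_def)
  qed (use right_mult_zero_mat[OF P] in \<open>simp add: t_def\<close>)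
  have tQ: "t j * (X * U) = t j" for j
  proof (cases "j \<le> ?m")
    case True
    have "U * X * s j * (X * U) * (X * U) = U * X * s j * (X * U * (X * U))"
      by (rule assoc_mult_mat[OF mult_carrier_mat[OF P sc[OF True]] Q Q])
    then show ?thesis using True by (simp add: t_def QQ)
  qed (use left_mult_zero_mat[OF Q] in \<open>simp add: t_def\<close>)
  define w where "w = reciprocal_seq t"
  have pair_t: "reciprocal_pair p q t w"
    unfolding w_def by (rule reciprocal_pair_reciprocal_seq[OF t]) (simp_all only: t0 X_def[symmetric] Pt tQ)

  define u' where "u' = plus_transform \<alpha> t"
  define v where "v = reciprocal_seq u'"
  have u'0: "u' 0 = U" by (simp add: u'_def t0)
  have u'c: "u' j \<in> carrier_mat p q" for j unfolding u'_def by (rule plus_transform_carrier[OF t])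
  have Pu': "U * X * u' j = u' j" for j
    unfolding u'_def by (simp only: plus_transform_mult_left[OF P t] Pt)
  have u'Q: "u' j * (X * U) = u' j" for j
    unfolding u'_def by (simp only: plus_transform_mult_right[OF Q t] tQ)
  have pair_u: "reciprocal_pair p q u' v"
    unfolding v_def by (rule reciprocal_pair_reciprocal_seq[OF u'c]) (simp_all only: u'0 X_def[symmetric] Pu' u'Q)
  interpret T: reciprocal_pair p q t w by (rule pair_t)
  interpret V: reciprocal_pair p q u' v by (rule pair_u)
  interpret V': reciprocal_pair q p v u' by (rule V.swap)
  have v0: "v 0 = X" using V.mp_inverse_u0 by (simp add: u'0 X_def)
  have w_v: "w = plus_transform \<alpha> v"
    by (rule reciprocal_plus_transform[OF pair_t]) (use pair_u in \<open>simp add: u'_def\<close>)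

  have u0: "u 0 = U" by (simp add: u_def U_def)
  have uc: "u j \<in> carrier_mat p q" if "j \<le> ?m" for j
    using that sc[of j] sc[of "j - 1"] by (auto simp: u_def plus_transform_def)
  have u_u': "u j = u' j" if "j \<le> 2 * n + 1" for j
    unfolding u_def u'_def using that by (intro plus_transform_cong) (simp add: t_s)
  have u'_compress: "u' j = U * X * u j * (X * U)" if j: "j \<le> ?m" for j
  proof -
    have "U * X * u j = plus_transform \<alpha> (\<lambda>i. U * X * s i) j"
      unfolding u_def by (rule plus_transform_mult_left[OF P, where c = q]) (use j sc in auto)
    also have "\<dots> * (X * U) = plus_transform \<alpha> (\<lambda>i. U * X * s i * (X * U)) j"
      by (rule plus_transform_mult_right[OF Q]) (use j in \<open>auto intro!: mult_carrier_mat[OF P sc]\<close>)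
    also have "\<dots> = u' j" unfolding u'_def by (rule plus_transform_cong) (use j in \<open>simp add: t_def\<close>)
    finally show ?thesis ..
  qed
  \<comment> \<open>The transform of the given sequence is reciprocal to the compressed one up to the last index.\<close>
  have sharp: "sharp_seq \<alpha> s j = v j" if "j \<le> ?m" for j
    unfolding sharp_seq_def u_def[symmetric] v_def
    by (rule reciprocal_seq_compress[OF pair_u[unfolded v_def] _ uc _ that])
      (simp_all add: u0 u'0 u'_compress X_def)

  have G_sharp: "G_mat q p n (sharp_seq \<alpha> s) = G_mat q p n v"
    by (rule G_mat_cong) (rule sharp)
  have Sl_sharp: "S_lower q p n (sharp_seq \<alpha> s) = S_lower q p n v"
    and Su_sharp: "S_upper q p n (sharp_seq \<alpha> s) = S_upper q p n v"
    by (rule S_lower_cong S_upper_cong, rule sharp, simp)+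
  have Lambda_sharp: "Lambda_Suc q p n (sharp_seq \<alpha> s) = Lambda_Suc q p n v"
    by (rule Lambda_Suc_cong) (rule sharp)
  have Sl_u: "S_lower p q n u = S_lower p q n u'" and Su_u: "S_upper p q n u = S_upper p q n u'"
    by (rule S_lower_cong S_upper_cong, rule u_u', simp)+
  have Sl_s: "S_lower p q k s = S_lower p q k t" and Su_s: "S_upper p q k s = S_upper p q k t"
    if "k \<le> n + 1" for k
    using that by (auto intro!: S_lower_cong S_upper_cong simp: t_s)

  \<comment> \<open>The blocks of \<open>\<Xi>\<close> are the differences \<open>u - u'\<close>, which vanish except for the index \<open>2n + 2\<close>. The
    term \<open>- \<alpha> s\<^sub>2\<^sub>n\<^sub>+\<^sub>1\<close> of \<open>u\<^sub>2\<^sub>n\<^sub>+\<^sub>2\<close> is unaffected by compression and cancels.\<close>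
  define Xi where "Xi = Xi_mat p q n ?m s"
  have Xi_block: "Xi = block_mat p q ?N ?N (\<lambda>j k. u (j + k + 2) - u' (j + k + 2))"
    unfolding Xi_def Xi_mat_def
  proof (rule block_mat_eqI)
    fix j k assume jk: "j < ?N" "k < ?N"
    show "(if j = n \<and> k = n then s ?m - s 0 * mp_inverse (s 0) * s ?m * mp_inverse (s 0) * s 0 else 0\<^sub>m p q)
        = u (j + k + 2) - u' (j + k + 2)"
    proof (cases "j = n \<and> k = n")
      case True
      have "U * X * s ?m * X * U = t ?m"
        using assoc_mult_mat[OF mult_carrier_mat[OF P sc] X U, of ?m] by (simp add: t_def)
      moreover have "u ?m - u' ?m = s ?m - t ?m"
        using sc[of ?m] t[of ?m] sc[of "?m - 1"] t_s[of "?m - 1"]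
        by (intro eq_matI) (auto simp: u_def u'_def plus_transform_def)
      moreover have "j + k + 2 = ?m" using True by simp
      ultimately show ?thesis using True by (simp add: U_def X_def mult_2)
    next
      case False
      then have "j + k + 2 \<le> 2 * n + 1" using jk by linarith
      then show ?thesis using False u_u' u'c[of "j + k + 2"] by auto
    qed
  qed
  have Xi: "Xi \<in> carrier_mat (?N * p) (?N * q)" unfolding Xi_block by (rule block_mat_carrier)
  have G_u: "G_mat p q n u = G_mat p q n u' + Xi"
  proof -
    have "Xi = G_mat p q n u - G_mat p q n u'"
      unfolding Xi_block G_mat_def block_hankel_def
      by (rule block_mat_minus[symmetric]) (auto intro!: uc u'c)
    then show ?thesis by (intro eq_matI) auto
  qed
  have Lambda_u: "Lambda_Suc p q n u - Xi = Lambda_Suc p q n u'"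
  proof -
    have 1: "block_column p q n (\<lambda>j. u (j + 1)) = block_column p q n (\<lambda>j. u' (j + 1))"
      by (rule block_column_cong) (rule u_u', simp)
    have 2: "block_row p q n (\<lambda>j. u (j + 1)) = block_row p q n (\<lambda>j. u' (j + 1))"
      by (rule block_row_cong) (rule u_u', simp)
    have *: "A + Xi - C - Xi = A - C" if "A \<in> carrier_mat (?N * p) (?N * q)" "C \<in> carrier_mat (?N * p) (?N * q)" for A C
      using that Xi by (intro eq_matI) auto
    then show ?thesis
      unfolding Lambda_Suc_def G_u 1 2 u0 u'0 by (intro *) (auto intro: carrier_matI)
  qed
  \<comment> \<open>\<open>P (u - u') Q = u' - u' = 0\<close>.\<close>
  have sandwich_Xi: "S_lower q p n v * Xi * S_upper q p n v = 0\<^sub>m (?N * q) (?N * p)"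
  proof -
    have zero: "v 0 = X" "u' 0 = U" by (rule v0, rule u'0)
    have "S_lower q p n v * Xi * S_upper q p n v
        = S_lower q p n v * block_mat p q ?N ?N (\<lambda>j k. U * X * (u (j + k + 2) - u' (j + k + 2)) * (X * U)) * S_upper q p n v"
      unfolding Xi_block using V.sandwich_compress[of n "\<lambda>j k. u (j + k + 2) - u' (j + k + 2)"] u'c
      by (simp add: zero minus_carrier_mat)
    also have "block_mat p q ?N ?N (\<lambda>j k. U * X * (u (j + k + 2) - u' (j + k + 2)) * (X * U))
        = 0\<^sub>m (?N * p) (?N * q)"
    proof -
      have "U * X * (u i - u' i) * (X * U) = 0\<^sub>m p q" if "i \<le> ?m" for i
      proof -
        have "U * X * (u i - u' i) = U * X * u i - u' i"
          using mult_minus_distrib_mat[OF P uc[OF that] u'c] by (simp add: Pu')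
        then have "U * X * (u i - u' i) * (X * U) = U * X * u i * (X * U) - u' i"
          using minus_mult_distrib_mat[OF mult_carrier_mat[OF P uc[OF that]] u'c Q] by (simp add: u'Q)
        also have "\<dots> = u' i - u' i" by (simp only: u'_compress[OF that])
        also have "\<dots> = 0\<^sub>m p q" using u'c[of i] by (intro eq_matI) auto
        finally show ?thesis .
      qed
      then have "block_mat p q ?N ?N (\<lambda>j k. U * X * (u (j + k + 2) - u' (j + k + 2)) * (X * U))
          = block_mat p q ?N ?N (\<lambda>j k. 0\<^sub>m p q)"
        by (intro block_mat_eqI) simp
      also have "\<dots> = 0\<^sub>m (?N * p) (?N * q)"
      proof (rule eq_matI_blocks[OF block_mat_carrier zero_carrier_mat])
        fix j k a b assume jk: "j < ?N" "k < ?N" and ab: "a < p" "b < q"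
        show "block_mat p q ?N ?N (\<lambda>j k. 0\<^sub>m p q) $$ (j * p + a, k * q + b)
            = 0\<^sub>m (?N * p) (?N * q) $$ (j * p + a, k * q + b)"
          by (simp only: index_block_mat[OF jk ab] index_zero_mat(1)[OF ab]
              index_zero_mat(1)[OF block_index_less[OF jk(1) ab(1)] block_index_less[OF jk(2) ab(2)]])
      qed
      finally show ?thesis .
    qed
    also have "S_lower q p n v * 0\<^sub>m (?N * p) (?N * q) * S_upper q p n v = 0\<^sub>m (?N * q) (?N * p)"
    proof -
      have "S_lower q p n v \<in> carrier_mat (?N * q) (?N * p)" "S_upper q p n v \<in> carrier_mat (?N * q) (?N * p)"
        by (auto intro: carrier_matI)
      then show ?thesis by (simp only: right_mult_zero_mat left_mult_zero_mat)
    qed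
    finally show ?thesis .
  qed
  have sandwich_Lambda: "S_lower q p n v * Lambda_Suc p q n u * S_upper q p n v
      = S_lower q p n v * Lambda_Suc p q n u' * S_upper q p n v"
  proof -
    have c: "S_lower q p n v \<in> carrier_mat (?N * q) (?N * p)" "S_upper q p n v \<in> carrier_mat (?N * q) (?N * p)"
      "Lambda_Suc p q n u \<in> carrier_mat (?N * p) (?N * q)" by (auto intro: carrier_matI)
    have "S_lower q p n v * Lambda_Suc p q n u' * S_upper q p n v
        = S_lower q p n v * Lambda_Suc p q n u * S_upper q p n v - S_lower q p n v * Xi * S_upper q p n v"
      unfolding Lambda_u[symmetric] using c Xi
      by (simp add: mult_minus_distrib_mat[of _ "?N * q" "?N * p" _ "?N * q"]
          minus_mult_distrib_mat[of _ "?N * q" "?N * q" _ _ "?N * p"])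
    also have "\<dots> = S_lower q p n v * Lambda_Suc p q n u * S_upper q p n v"
      unfolding sandwich_Xi using c by (intro eq_matI) (auto simp del: index_mult_mat(1))
    finally show ?thesis ..
  qed

  \<comment> \<open>Since \<open>w = (1 - \<alpha> z) v\<close>, multiplication with the geometric series recovers \<open>v\<close>.\<close>
  have R_lower: "R_mat q n \<alpha> * mp_inverse (S_lower p q n s) = S_lower q p n v"
    by (simp add: Sl_s T.mp_inverse_S_lower w_v S_lower_plus_transform[OF V.v])
  have R_upper: "mp_inverse (S_upper p q n s) * mat_adjoint (R_mat p n (cnj \<alpha>)) = S_upper q p n v"
    by (simp add: Su_s T.mp_inverse_S_upper w_v S_upper_plus_transform[OF V.v])
  have R_sandwich: "R_mat q n \<alpha> * mp_inverse (S_lower p q n s) * M * mp_inverse (S_upper p q n s)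
      * mat_adjoint (R_mat p n (cnj \<alpha>)) = S_lower q p n v * M * S_upper q p n v"
    if "M \<in> carrier_mat (?N * p) (?N * q)" for M
    unfolding R_lower R_upper[symmetric] using that
    by (intro mult_mat_assoc) (auto simp: R_mat_eq)

  have a1: "G_mat q p n v = - (S_lower q p n v * Lambda_Suc p q n u * S_upper q p n v)"
    unfolding sandwich_Lambda by (rule V.G_eq_Lambda)
  have a2: "G_mat q p n v = - (R_mat q n \<alpha> * mp_inverse (S_lower p q n s) * Lambda_Suc p q n u
      * mp_inverse (S_upper p q n s) * mat_adjoint (R_mat p n (cnj \<alpha>)))"
    by (subst R_sandwich) (auto intro: carrier_matI a1)
  have a3: "G_mat q p n v =
       - (mat_adjoint (nabla_mat q (n + 1)) * mp_inverse (S_lower p q (n + 1) s)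
          * block_hankel p q (n + 1) s
          * mp_inverse (S_upper p q (n + 1) s) * nabla_mat p (n + 1))
       - \<alpha> \<cdot>\<^sub>m (R_mat q n \<alpha> * mp_inverse (S_lower p q n s) * H_shift \<alpha> p q n s
               * mp_inverse (S_upper p q n s) * mat_adjoint (R_mat p n (cnj \<alpha>)))"
  proof -
    have H: "H_shift \<alpha> p q n s = block_hankel p q n (\<lambda>j. u' (j + 1))"
      unfolding H_shift_def shift_seq_eq u_def[symmetric]
      by (rule block_hankel_cong) (rule u_u', simp)
    have second: "R_mat q n \<alpha> * mp_inverse (S_lower p q n s) * H_shift \<alpha> p q n s
               * mp_inverse (S_upper p q n s) * mat_adjoint (R_mat p n (cnj \<alpha>))
        = - block_hankel q p n (\<lambda>m. v (m + 1))"
      unfolding H by (rule trans[OF R_sandwich V.hankel_eq]) (auto intro: carrier_matI)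
    \<comment> \<open>The Hankel matrix of \<open>s\<close> reaches up to \<open>s\<^sub>2\<^sub>n\<^sub>+\<^sub>2\<close>, so it has to be compressed to that of \<open>t\<close>.\<close>
    have comp: "S_lower q p (n + 1) w * block_hankel p q (n + 1) s * S_upper q p (n + 1) w
        = S_lower q p (n + 1) w * block_hankel p q (n + 1) t * S_upper q p (n + 1) w"
    proof -
      have tw: "t 0 * w 0 = U * X" "w 0 * t 0 = X * U"
        using T.mp_inverse_u0 by (simp_all add: t0 X_def)
      have "S_lower q p (n + 1) w * block_hankel p q (n + 1) s * S_upper q p (n + 1) w
        = S_lower q p (n + 1) w * block_mat p q (n + 1 + 1) (n + 1 + 1)
            (\<lambda>j k. U * X * s (j + k) * (X * U)) * S_upper q p (n + 1) w"
        unfolding block_hankel_def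
        by (rule T.sandwich_compress[of "n + 1" "\<lambda>j k. s (j + k)", unfolded tw], rule sc) simp
      also have "block_mat p q (n + 1 + 1) (n + 1 + 1) (\<lambda>j k. U * X * s (j + k) * (X * U))
          = block_hankel p q (n + 1) t"
        unfolding block_hankel_def by (rule block_mat_eqI) (simp add: t_def)
      finally show ?thesis .
    qed
    have shuffle: "mat_adjoint (nabla_mat q (n + 1)) * A * M * B * nabla_mat p (n + 1)
        = mat_adjoint (nabla_mat q (n + 1)) * (A * M * B) * nabla_mat p (n + 1)"
      if "A \<in> carrier_mat ((n + 2) * q) ((n + 2) * p)" "M \<in> carrier_mat ((n + 2) * p) ((n + 2) * q)"
        "B \<in> carrier_mat ((n + 2) * q) ((n + 2) * p)" for A M B
      using that by (simp add: mult_mat_assoc nabla_mat_block)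
    have first: "mat_adjoint (nabla_mat q (n + 1)) * mp_inverse (S_lower p q (n + 1) s)
          * block_hankel p q (n + 1) s
          * mp_inverse (S_upper p q (n + 1) s) * nabla_mat p (n + 1) = - G_mat q p n w"
    proof -
      have Sw: "mp_inverse (S_lower p q (n + 1) s) = S_lower q p (n + 1) w"
        "mp_inverse (S_upper p q (n + 1) s) = S_upper q p (n + 1) w"
        by (simp_all add: Sl_s Su_s T.mp_inverse_S_lower T.mp_inverse_S_upper)
      have c: "S_lower q p (n + 1) w \<in> carrier_mat ((n + 2) * q) ((n + 2) * p)"
        "block_hankel p q (n + 1) x \<in> carrier_mat ((n + 2) * p) ((n + 2) * q)"
        "S_upper q p (n + 1) w \<in> carrier_mat ((n + 2) * q) ((n + 2) * p)" for x
        by (intro carrier_matI, simp, simp)+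
      show ?thesis
        unfolding Sw T.nabla_hankel_eq[symmetric] shuffle[OF c] comp ..
    qed
    \<comment> \<open>The two summands of the claim are \<open>G(w)\<close> and \<open>\<alpha>\<close> times the Hankel matrix of \<open>v\<^sub>1, v\<^sub>2, \<dots>\<close>;
      they add up because \<open>w = (1 - \<alpha> z) v\<close>.\<close>
    have wc: "v (j + 2) = w (j + 2) + \<alpha> \<cdot>\<^sub>m v (j + 1)" for j
      unfolding w_v plus_transform_def using V.v[of "j + 2"] V.v[of "j + 1"] by (intro eq_matI) auto
    have "G_mat q p n v = G_mat q p n w + \<alpha> \<cdot>\<^sub>m block_hankel q p n (\<lambda>m. v (m + 1))"
    proof (rule eq_matI_blocks[of _ ?N q ?N p])
      fix j k a b assume jk: "j < ?N" "k < ?N" and ab: "a < q" "b < p"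
      have "(G_mat q p n w + \<alpha> \<cdot>\<^sub>m block_hankel q p n (\<lambda>m. v (m + 1))) $$ (j * q + a, k * p + b)
          = G_mat q p n w $$ (j * q + a, k * p + b)
            + \<alpha> * block_hankel q p n (\<lambda>m. v (m + 1)) $$ (j * q + a, k * p + b)"
        using block_index_less[OF jk(1) ab(1)] block_index_less[OF jk(2) ab(2)] by simp
      also have "\<dots> = w (j + k + 2) $$ (a, b) + \<alpha> * v (j + k + 1) $$ (a, b)"
        unfolding G_mat_def block_hankel_def by (simp only: index_block_mat[OF jk ab])
      also have "\<dots> = v (j + k + 2) $$ (a, b)"
        using ab V.v[of "j + k + 1"] T.v[of "j + k + 2"] by (subst wc) auto
      also have "\<dots> = G_mat q p n v $$ (j * q + a, k * p + b)"
        unfolding G_mat_def block_hankel_def by (simp only: index_block_mat[OF jk ab])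
      finally show "G_mat q p n v $$ (j * q + a, k * p + b)
          = (G_mat q p n w + \<alpha> \<cdot>\<^sub>m block_hankel q p n (\<lambda>m. v (m + 1))) $$ (j * q + a, k * p + b)" ..
    qed (auto intro: carrier_matI)
    then show ?thesis unfolding first second by (intro eq_matI) auto
  qed
  have b: "G_mat p q n u = Xi - S_lower p q n u' * Lambda_Suc q p n v * S_upper p q n u'"
    unfolding G_u V'.G_eq_Lambda using Xi by (intro eq_matI) (auto simp del: index_mult_mat(1))
  have c: "rank_of (G_mat q p n v) = rank_of (Lambda_Suc p q n u - Xi)"
    unfolding Lambda_u by (rule V.rank_G_eq)
  have d: "det (G_mat q p n v) = (inverse (det (s 0))) ^ (2 * n + 2) * det (- Lambda_Suc p q n u)"
    if pq: "p = q"
  proof -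
    have cc: "S_lower q p n v \<in> carrier_mat (?N * q) (?N * q)" "S_upper q p n v \<in> carrier_mat (?N * q) (?N * q)"
      "- Lambda_Suc p q n u \<in> carrier_mat (?N * q) (?N * q)" using pq by (auto intro: carrier_matI)
    have vq: "v j \<in> carrier_mat q q" for j using V.v pq by simp
    have "det (G_mat q p n v) = det (S_lower q p n v * - Lambda_Suc p q n u * S_upper q p n v)"
      unfolding a1 by simp
    also have "\<dots> = det (S_lower q p n v) * det (- Lambda_Suc p q n u) * det (S_upper q p n v)"
      by (simp only: det_mult[OF mult_carrier_mat[OF cc(1,3)] cc(2)] det_mult[OF cc(1,3)])
    also have "det (S_lower q p n v) = det X ^ (n + 1)" using det_S_lower[of v q n] vq pq by (simp add: v0)
    also have "det (S_upper q p n v) = det X ^ (n + 1)" using det_S_upper[of v q n] vq pq by (simp add: v0)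
    also have "det X = inverse (det (s 0))"
      unfolding X_def U_def[symmetric] by (rule det_mp_inverse[of U q]) (use U pq in simp)
    finally show ?thesis by (simp add: power_add[symmetric] mult_2 flip: power_add)
  qed
  show ?thesis
    unfolding Lambda_plus_transform u_def[symmetric] G_sharp Sl_sharp Su_sharp Lambda_sharp
      Sl_u Su_u Xi_def[symmetric]
    using a1 a2 a3 b c d by simp
qed

end
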